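(* Let $d\geq 2$, $0<p<1$, and let $\Omega$ be a bounded open subset of $\mathbb{R}^d$. If $H:\Omega\to SO(d)$ is Riemann integrable, then $(\mathrm{id}_\Omega,H)\in\mathcal{M}^{1,p}_\lambda(\Omega)$.
   Context: $SO(d)$ is the group of real orthogonal $d\times d$ matrices of determinant $1$; $H$ Riemann integrable means that each of its $d^2$ entries is a Riemann integrable function on $\Omega$. $\lambda$ is Lebesgue measure, $\mathrm{id}_\Omega$ is the identity map of $\Omega$, and $Df$ is the Jacobian matrix of $f$. For $0<p<1$, $L^p(\Omega)^{d^2}$ is identified with $d\times d$ matrix-valued functions with entries in $L^p(\Omega)$, with quasi-norm the maximum of the quasi-norms $\|g\|_p=\left(\int_\Omega|g|^p\right)^{1/p}$ of the entries. For $\Omega\subset\mathbb{R}^d$ bounded and open, $\mathcal{M}^{1,p}_\lambda(\Omega)$ denotes the set of pairs $(f,F)\in L^p(\Omega)^d\times L^p(\Omega)^{d^2}$ for which there exists a sequence $(f_n)_n$ of volume preserving (i.e. preserving $\lambda$) $C^1$ homeomorphisms from $\Omega$ onto $\Omega$, each continuous to the boundary (i.e. extending continuously to $\overline{\Omega}$), converging uniformly to $f$ and such that $(Df_n)_n$ converges to $F$ in $L^p(\Omega)^{d^2}$. *)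

theory Defs
  imports "HOL-Analysis.Analysis"
begin

text \<open>
  Darboux integrability of a real function on a bounded open set \<open>\<Omega>\<close> that need not be
  Jordan measurable. The cells of a Darboux sum are the traces \<open>K \<inter> \<Omega>\<close> of the boxes of
  a finite non-overlapping family covering \<open>\<Omega>\<close>, weighted by their Lebesgue measure. If the
  boundary of \<open>\<Omega>\<close> is null, this is the usual Riemann integrability of the extension of \<open>f\<close>
  by zero to a box. In general it is implied by the latter, but the extension by zero of a
  function such as the constant \<open>1\<close> is never Riemann integrable when the boundary of
  \<open>\<Omega>\<close> has positive measure. When \<open>K \<inter> \<Omega>\<close> is empty, the unspecified value of the
  supremum or infimum is multiplied by \<open>0\<close>.
\<close>

definition covering_divisions :: "'a::euclidean_space set \<Rightarrow> 'a set set set" where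
  "covering_divisions \<Omega> = {P. P division_of \<Union>P \<and> \<Omega> \<subseteq> \<Union>P}"

definition upper_sum :: "('a::euclidean_space \<Rightarrow> real) \<Rightarrow> 'a set \<Rightarrow> 'a set set \<Rightarrow> real" where
  "upper_sum f \<Omega> P = (\<Sum>K\<in>P. (SUP x\<in>K \<inter> \<Omega>. f x) * measure lebesgue (K \<inter> \<Omega>))"

definition lower_sum :: "('a::euclidean_space \<Rightarrow> real) \<Rightarrow> 'a set \<Rightarrow> 'a set set \<Rightarrow> real" where
  "lower_sum f \<Omega> P = (\<Sum>K\<in>P. (INF x\<in>K \<inter> \<Omega>. f x) * measure lebesgue (K \<inter> \<Omega>))"

definition riemann_integrable_on :: "('a::euclidean_space \<Rightarrow> real) \<Rightarrow> 'a set \<Rightarrow> bool" where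
  "riemann_integrable_on f \<Omega> \<longleftrightarrow>
     bounded (f ` \<Omega>) \<and>
     (SUP P\<in>covering_divisions \<Omega>. lower_sum f \<Omega> P) = (INF P\<in>covering_divisions \<Omega>. upper_sum f \<Omega> P)"

definition matrix_riemann_integrable_on ::
    "(real^'n \<Rightarrow> real^'n^'n) \<Rightarrow> (real^'n) set \<Rightarrow> bool" where
  "matrix_riemann_integrable_on H \<Omega> \<longleftrightarrow> (\<forall>i j. riemann_integrable_on (\<lambda>x. H x $ i $ j) \<Omega>)"

definition special_orthogonal :: "(real^'n^'n) set" where
  "special_orthogonal = {A. orthogonal_matrix A \<and> det A = 1}"

text \<open>Elements of \<open>L\<^sup>p\<close> are represented by functions; only the values on \<open>\<Omega>\<close> matter.\<close>

definition Lp_functions :: "real \<Rightarrow> 'a::euclidean_space set \<Rightarrow> ('a \<Rightarrow> real) set" where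
  "Lp_functions p \<Omega> =
     {g. g \<in> borel_measurable (lebesgue_on \<Omega>) \<and> integrable (lebesgue_on \<Omega>) (\<lambda>x. \<bar>g x\<bar> powr p)}"

definition Lp_quasinorm :: "real \<Rightarrow> 'a::euclidean_space set \<Rightarrow> ('a \<Rightarrow> real) \<Rightarrow> real" where
  "Lp_quasinorm p \<Omega> g = (integral\<^sup>L (lebesgue_on \<Omega>) (\<lambda>x. \<bar>g x\<bar> powr p)) powr (1 / p)"

definition Lp_vector_functions :: "real \<Rightarrow> (real^'n) set \<Rightarrow> (real^'n \<Rightarrow> real^'n) set" where
  "Lp_vector_functions p \<Omega> = {f. \<forall>i. (\<lambda>x. f x $ i) \<in> Lp_functions p \<Omega>}"

definition Lp_matrix_functions :: "real \<Rightarrow> (real^'n) set \<Rightarrow> (real^'n \<Rightarrow> real^'n^'n) set" where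
  "Lp_matrix_functions p \<Omega> = {F. \<forall>i j. (\<lambda>x. F x $ i $ j) \<in> Lp_functions p \<Omega>}"

definition Lp_matrix_quasinorm :: "real \<Rightarrow> (real^'n) set \<Rightarrow> (real^'n \<Rightarrow> real^'n^'n) \<Rightarrow> real" where
  "Lp_matrix_quasinorm p \<Omega> F = Max {Lp_quasinorm p \<Omega> (\<lambda>x. F x $ i $ j) | i j. True}"

text \<open>
  Membership of the terms and of the limit in \<open>L\<^sup>p\<close> is required explicitly, because the
  Bochner integral of a non-integrable function is \<open>0\<close>.
\<close>

definition converges_in_Lp_matrix ::
    "real \<Rightarrow> (real^'n) set \<Rightarrow> (nat \<Rightarrow> real^'n \<Rightarrow> real^'n^'n) \<Rightarrow> (real^'n \<Rightarrow> real^'n^'n) \<Rightarrow> bool" where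
  "converges_in_Lp_matrix p \<Omega> G F \<longleftrightarrow>
     (\<forall>n. G n \<in> Lp_matrix_functions p \<Omega>) \<and> F \<in> Lp_matrix_functions p \<Omega> \<and>
     (\<lambda>n. Lp_matrix_quasinorm p \<Omega> (\<lambda>x. G n x - F x)) \<longlonglongrightarrow> 0"

definition C1_on :: "(real^'n) set \<Rightarrow> (real^'n \<Rightarrow> real^'n) \<Rightarrow> bool" where
  "C1_on \<Omega> f \<longleftrightarrow>
     (\<forall>x\<in>\<Omega>. f differentiable (at x)) \<and> continuous_on \<Omega> (\<lambda>x. jacobian f (at x))"

definition volume_preserving_on :: "'a::euclidean_space set \<Rightarrow> ('a \<Rightarrow> 'a) \<Rightarrow> bool" where
  "volume_preserving_on \<Omega> f \<longleftrightarrow>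
     f \<in> lebesgue_on \<Omega> \<rightarrow>\<^sub>M lebesgue_on \<Omega> \<and>
     distr (lebesgue_on \<Omega>) (lebesgue_on \<Omega>) f = lebesgue_on \<Omega>"

definition continuous_to_boundary :: "(real^'n) set \<Rightarrow> (real^'n \<Rightarrow> real^'n) \<Rightarrow> bool" where
  "continuous_to_boundary \<Omega> f \<longleftrightarrow>
     (\<exists>g. continuous_on (closure \<Omega>) g \<and> (\<forall>x\<in>\<Omega>. g x = f x))"

definition admissible_maps :: "(real^'n) set \<Rightarrow> (real^'n \<Rightarrow> real^'n) set" where
  "admissible_maps \<Omega> =
     {f. (\<exists>g. homeomorphism \<Omega> \<Omega> f g) \<and> C1_on \<Omega> f \<and> volume_preserving_on \<Omega> f \<and>
         continuous_to_boundary \<Omega> f}"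

definition M1p :: "real \<Rightarrow> (real^'n) set \<Rightarrow> ((real^'n \<Rightarrow> real^'n) \<times> (real^'n \<Rightarrow> real^'n^'n)) set" where
  "M1p p \<Omega> =
     {(f, F). f \<in> Lp_vector_functions p \<Omega> \<and> F \<in> Lp_matrix_functions p \<Omega> \<and>
        (\<exists>fs. (\<forall>n. fs n \<in> admissible_maps \<Omega>) \<and>
              uniform_limit \<Omega> fs f sequentially \<and>
              converges_in_Lp_matrix p \<Omega> (\<lambda>n x. jacobian (fs n) (at x)) F)}"

end

theory Submission
  imports Defs
begin

text \<open>
  Volume preserving homeomorphisms close to the identity can have derivatives close to
  prescribed rotations on most of \<open>\<Omega>\<close>. In a ball with centre \<open>c\<close>, rotate each sphere around \<open>c\<close>
  by its own rotation: by a fixed \<open>A\<close> for the spheres in a slightly smaller concentric ball, the core,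
  and by rotations that lead from \<open>A\<close> back to the identity in the thin shell around the core. Such a
  twist, \<open>x \<mapsto> c + Q (|x - c|\<^sup>2) (x - c)\<close> with a \<open>C\<^sup>1\<close> path \<open>Q\<close> of orthogonal matrices, is a \<open>C\<^sup>1\<close>
  bijection of the ball that agrees with the identity to first order at the boundary sphere.
  Its derivative is a shear followed by a rotation (\<open>rotated_shear_twist_jacobian\<close>), so it
  preserves volume. It moves points by at most the diameter of the ball.

  The derivative is \<open>A\<close> on the core. In a shell of relative thickness \<open>\<delta>\<close> it has size \<open>1/\<delta>\<close>, but
  the shell only has a fraction of about \<open>\<delta>\<close> of the volume, so its contribution to the integral
  of the \<open>p\<close>-th power is of order \<open>\<delta> powr (1 - p)\<close>. This is where \<open>p < 1\<close> enters
  (\<open>thin_shell_profile\<close>). The path \<open>Q\<close> exists because \<open>A\<close> is a product of an even number of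
  reflections, and the product of two reflections is joined to the identity by moving one mirror
  into the other (\<open>C1_orthogonal_path_special_orthogonal\<close>).

  A Riemann integrable \<open>H\<close> varies by at most \<open>\<epsilon>\<close> in a neighbourhood of almost every point
  (\<open>riemann_integrable_AE_nearly_constant\<close>). By the Vitali covering theorem, finitely many disjoint
  balls of radius at most \<open>\<epsilon>\<close> on which \<open>H\<close> varies by at most \<open>\<epsilon>\<close> cover \<open>\<Omega>\<close> up to measure \<open>\<epsilon>\<close>
  (\<open>finite_ball_packing\<close>). Twisting all of them at once, with the value of \<open>H\<close> at the centre as the
  rotation of the core, gives a map that is uniformly close to the identity and whose derivative is
  close to \<open>H\<close> in \<open>L\<^sup>p\<close> (\<open>admissible_map_near_id_jacobian_near\<close>). The theorem follows by letting
  \<open>\<epsilon>\<close> tend to \<open>0\<close>.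
\<close>

section \<open>Rank-one matrices and reflections\<close>

text \<open>
  As a rewrite rule, this equation turns \<open>transpose A *v x\<close> into \<open>x v* A\<close>, which hides the cancellation of a matrix
  against its transpose in products that act on a vector.
\<close>

declare transpose_matrix_vector [simp del]

lemma axis_nth_if: "axis i x $ j = (if j = i then x else 0)"
  by (simp add: axis_def)

definition outer :: "real^'n \<Rightarrow> real^'n \<Rightarrow> real^'n^'n" where
  "outer v w = (\<chi> i j. v $ i * w $ j)"

lemma outer_mult_vec: "outer v w *v x = (w \<bullet> x) *\<^sub>R v"
  by (simp add: outer_def vec_eq_iff matrix_vector_mult_def inner_vec_def sum_distrib_left
      sum_distrib_right mult_ac)

lemma bounded_bilinear_outer: "bounded_bilinear outer"
  unfolding bilinear_conv_bounded_bilinear[symmetric] bilinear_def outer_def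
  by (auto intro!: linearI simp: vec_eq_iff algebra_simps)

lemma bounded_bilinear_matrix_mult:
  "bounded_bilinear (\<lambda>(A::real^'n^'m) (B::real^'k^'n). A ** B)"
  unfolding bilinear_conv_bounded_bilinear[symmetric] bilinear_def
  by (auto intro!: linearI simp: vec_eq_iff matrix_matrix_mult_def sum.distrib algebra_simps
      sum_distrib_left)

lemma bounded_bilinear_matrix_vector_mult:
  "bounded_bilinear (\<lambda>(A::real^'n^'m) (x::real^'n). A *v x)"
  unfolding bilinear_conv_bounded_bilinear[symmetric] bilinear_def
  by (auto intro!: linearI simp: vec_eq_iff matrix_vector_mult_def sum.distrib algebra_simps
      sum_distrib_left)

text \<open>
  The reflection in the hyperplane orthogonal to \<open>v\<close>. Since \<open>2 / 0 = 0\<close>, \<open>reflection 0\<close> is the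
  identity, an orthogonal involution as well, but one of determinant \<open>1\<close>.
\<close>

definition reflection :: "real^'n \<Rightarrow> real^'n^'n" where
  "reflection v = mat 1 - (2 / (v \<bullet> v)) *\<^sub>R outer v v"

lemma reflection_mult_vec: "reflection v *v x = x - (2 * (v \<bullet> x) / (v \<bullet> v)) *\<^sub>R v"
  by (simp add: reflection_def matrix_vector_mult_diff_rdistrib scaleR_matrix_vector_assoc[symmetric]
      outer_mult_vec)

lemma matrix_eqI: "(\<And>x. A *v x = B *v x) \<Longrightarrow> A = (B::real^'n^'m)"
  by (simp add: matrix_eq)

lemma reflection_reflection: "reflection v *v (reflection v *v x) = x"
proof -
  define a where "a = 2 * (v \<bullet> x) / (v \<bullet> v)"
  have "2 * (v \<bullet> (x - a *\<^sub>R v)) / (v \<bullet> v) = - a" if "v \<noteq> 0"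
    using that by (simp add: a_def inner_diff_right divide_simps)
  then show ?thesis
    by (cases "v = 0") (simp_all add: reflection_mult_vec flip: a_def)
qed

lemma reflection_involution: "reflection v ** reflection v = mat 1"
  by (rule matrix_eqI) (simp add: matrix_vector_mul_assoc[symmetric] reflection_reflection)

lemma transpose_reflection: "transpose (reflection v) = reflection v"
  by (simp add: vec_eq_iff transpose_def reflection_def outer_def mat_def)

lemma orthogonal_reflection: "orthogonal_matrix (reflection v)"
  by (simp add: orthogonal_matrix transpose_reflection reflection_involution)

lemma orthogonal_matrix_iff_inner:
  "orthogonal_matrix (A::real^'n^'n) \<longleftrightarrow> (\<forall>x y. (A *v x) \<bullet> (A *v y) = x \<bullet> y)"
  using orthogonal_transformation_matrix[of "(*v) A"]
  by (simp add: orthogonal_transformation_def)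

lemma det_orthogonal_conjugate:
  fixes S :: "real^'n^'n"
  assumes "orthogonal_matrix S"
  shows "det (S ** A ** transpose S) = det A"
proof -
  have "det S * det (transpose S) = 1"
    using assms by (metis det_I det_mul orthogonal_matrix_def)
  then show ?thesis by (simp add: det_mul mult_ac)
qed

text \<open>
  The reflection in \<open>y\<close> fixes \<open>w\<close> and reverses \<open>y\<close>, so it conjugates \<open>1 + w y\<^sup>T\<close> to \<open>1 - w y\<^sup>T\<close>,
  which is its inverse because \<open>w \<bullet> y = 0\<close>. Hence the determinant is its own inverse.
\<close>

lemma det_mat1_plus_outer:
  fixes w y :: "real^'n"
  assumes "w \<bullet> y = 0"
  shows "\<bar>det (mat 1 + outer w y)\<bar> = 1"
proof -
  let ?N = "mat 1 + outer w y" and ?M = "mat 1 - outer w y" and ?S = "reflection y"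
  have "?N ** ?M = mat 1"
    using assms by (intro matrix_eqI) (auto simp: matrix_vector_mul_assoc[symmetric]
        matrix_vector_mult_diff_rdistrib matrix_vector_mult_add_rdistrib outer_mult_vec algebra_simps inner_commute)
  then have "det ?N * det ?M = 1"
    by (metis det_I det_mul)
  moreover have "?S ** ?N ** transpose ?S = ?M"
  proof (rule matrix_eqI)
    fix x
    have "y \<bullet> (?S *v x) = - (y \<bullet> x)"
      by (cases "y = 0") (simp_all add: reflection_mult_vec inner_diff_right)
    moreover have "?S *v w = w"
      using assms by (simp add: reflection_mult_vec inner_commute)
    ultimately show "(?S ** ?N ** transpose ?S) *v x = ?M *v x"
      by (simp add: matrix_vector_mul_assoc[symmetric] transpose_reflection reflection_reflection
          matrix_vector_mult_diff_rdistrib matrix_vector_mult_add_rdistrib outer_mult_vec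
          matrix_vector_right_distrib matrix_vector_mult_diff_distrib matrix_vector_mult_scaleR)
  qed
  then have "det ?M = det ?N"
    using det_orthogonal_conjugate[OF orthogonal_reflection] by metis
  ultimately show ?thesis
    by (metis abs_square_eq_1 power2_eq_square)
qed

text \<open>
  An orthogonal matrix that sends a coordinate vector to the direction of \<open>v\<close> conjugates
  \<open>reflection v\<close> to a diagonal matrix with exactly one entry \<open>-1\<close>.
\<close>

lemma det_reflection:
  fixes v :: "real^'n"
  assumes "v \<noteq> 0"
  shows "det (reflection v) = -1"
proof -
  obtain k :: 'n where True by simp
  let ?e = "axis k 1 :: real^'n"
  obtain A where A: "orthogonal_matrix A" "A *v ?e = v /\<^sub>R norm v"
    using orthogonal_matrix_exists_basis[of "v /\<^sub>R norm v" k] assms by auto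
  have "A ** reflection ?e ** transpose A = reflection v"
  proof (rule matrix_eqI)
    fix x
    have "?e \<bullet> (transpose A *v x) = (v \<bullet> x) / norm v"
      by (simp add: transpose_matrix_vector inner_commute[of ?e] dot_lmul_matrix A(2) divide_inverse_commute inner_commute[of x])
    moreover have "A *v (transpose A *v x) = x"
      using A(1) by (simp add: matrix_vector_mul_assoc orthogonal_matrix_def)
    ultimately show "(A ** reflection ?e ** transpose A) *v x = reflection v *v x"
      using assms A(2) by (simp add: matrix_vector_mul_assoc[symmetric] reflection_mult_vec
          matrix_vector_mult_diff_distrib matrix_vector_mult_scaleR inner_axis_axis
          dot_square_norm power2_eq_square divide_simps)
  qed
  then have "det (reflection v) = det (reflection ?e)"
    using det_orthogonal_conjugate[OF A(1)] by metis
  also have "\<dots> = (\<Prod>i\<in>UNIV. reflection ?e $ i $ i)"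
    by (rule det_diagonal) (auto simp: reflection_def outer_def mat_def axis_def)
  also have "\<dots> = (\<Prod>i\<in>UNIV. if i = k then -1 else 1)"
    by (rule prod.cong) (simp_all add: reflection_def outer_def mat_def inner_axis_axis axis_nth_if)
  finally show ?thesis by simp
qed

text \<open>
  The theorem of Cartan and Dieudonne, by induction on the number of coordinate vectors that
  \<open>A\<close> moves. If \<open>A\<close> moves \<open>e\<^sub>k\<close>, the reflection in \<open>v = A e\<^sub>k - e\<^sub>k\<close> sends \<open>A e\<^sub>k\<close> back to \<open>e\<^sub>k\<close>
  and, as \<open>v\<close> is orthogonal to every coordinate vector that \<open>A\<close> fixes, undoes no progress.
\<close>

lemma orthogonal_matrix_product_of_reflections:
  fixes A :: "real^'n^'n"
  assumes "orthogonal_matrix A"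
  shows "\<exists>vs. 0 \<notin> set vs \<and> A = foldr (\<lambda>v B. reflection v ** B) vs (mat 1)"
  using assms
proof (induction "card {i. A *v axis i 1 \<noteq> axis i 1}" arbitrary: A rule: less_induct)
  case less
  show ?case
  proof (cases "\<forall>i. A *v axis i 1 = axis i 1")
    case True
    then have "A = mat 1"
      by (simp add: vec_eq_iff matrix_vector_mult_basis column_def mat_def axis_nth_if)
    then show ?thesis by (intro exI[of _ "[]"]) auto
  next
    case False
    then obtain k where k: "A *v axis k 1 \<noteq> axis k 1" by auto
    define v where "v = A *v axis k 1 - axis k 1"
    have inn: "(A *v x) \<bullet> (A *v y) = x \<bullet> y" for x y
      using less.prems by (simp add: orthogonal_matrix_iff_inner)
    have "v \<noteq> 0" using k by (simp add: v_def)
    let ?B = "reflection v ** A"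
    have Bk: "?B *v axis k 1 = axis k 1"
    proof -
      \<comment> \<open>because \<open>A e\<^sub>k\<close> and \<open>e\<^sub>k\<close> have the same length\<close>
      have "v \<bullet> v = 2 * (v \<bullet> (A *v axis k 1))"
        using inn[of "axis k 1" "axis k 1"]
        by (simp add: v_def inner_diff_left inner_diff_right inner_commute)
      with \<open>v \<noteq> 0\<close> have "2 * (v \<bullet> (A *v axis k 1)) / (v \<bullet> v) = 1"
        by (metis divide_self inner_eq_zero_iff)
      then have "?B *v axis k 1 = A *v axis k 1 - v"
        by (simp only: matrix_vector_mul_assoc[symmetric] reflection_mult_vec scaleR_one)
      then show ?thesis by (simp add: v_def)
    qed
    have Bi: "?B *v axis i 1 = axis i 1" if "A *v axis i 1 = axis i 1" for i
    proof -
      have "v \<bullet> axis i 1 = 0"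
        using inn[of "axis k 1" "axis i 1"] that by (simp add: v_def inner_diff_left)
      then show ?thesis
        using that by (simp add: matrix_vector_mul_assoc[symmetric] reflection_mult_vec)
    qed
    have "{i. ?B *v axis i 1 \<noteq> axis i 1} \<subset> {i. A *v axis i 1 \<noteq> axis i 1}"
      using k Bk Bi by blast
    then have "card {i. ?B *v axis i 1 \<noteq> axis i 1} < card {i. A *v axis i 1 \<noteq> axis i 1}"
      by (intro psubset_card_mono) auto
    moreover have "orthogonal_matrix ?B"
      by (intro orthogonal_matrix_mul orthogonal_reflection less.prems)
    ultimately obtain vs where vs: "0 \<notin> set vs"
        "?B = foldr (\<lambda>v B. reflection v ** B) vs (mat 1)"
      using less.hyps by blast
    have "A = reflection v ** ?B"
      by (simp add: matrix_mul_assoc reflection_involution)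
    with vs \<open>v \<noteq> 0\<close> show ?thesis
      by (intro exI[of _ "v # vs"]) auto
  qed
qed

section \<open>Continuously differentiable paths of orthogonal matrices\<close>

lemma C1_differentiable_on_bilinear:
  assumes "bounded_bilinear bop" "f C1_differentiable_on S" "g C1_differentiable_on S"
  shows "(\<lambda>t. bop (f t) (g t)) C1_differentiable_on S"
proof -
  interpret bounded_bilinear bop by fact
  from assms(2,3) obtain f' g' where
    f': "\<And>t. t \<in> S \<Longrightarrow> (f has_vector_derivative f' t) (at t)" "continuous_on S f'" and
    g': "\<And>t. t \<in> S \<Longrightarrow> (g has_vector_derivative g' t) (at t)" "continuous_on S g'"
    unfolding C1_differentiable_on_def by blast
  have "continuous_on S f" "continuous_on S g"
    using f' g' by (auto intro!: continuous_at_imp_continuous_on has_vector_derivative_continuous)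
  then show ?thesis
    unfolding C1_differentiable_on_def
    by (intro exI[of _ "\<lambda>t. bop (f t) (g' t) + bop (f' t) (g t)"] conjI ballI
        has_vector_derivative f' g' continuous_on_add continuous_on)
qed

definition C1_orthogonal_path :: "(real \<Rightarrow> real^'n^'n) \<Rightarrow> bool" where
  "C1_orthogonal_path Q \<longleftrightarrow> Q C1_differentiable_on UNIV \<and> (\<forall>t. orthogonal_matrix (Q t))"

text \<open>
  The path is \<open>reflection (u t) ** reflection w\<close>, where \<open>u\<close> runs along the line from \<open>w\<close> to \<open>v\<close>. The
  line misses the origin unless \<open>v\<close> and \<open>w\<close> are parallel; then the two reflections coincide,
  their product is the identity, and a constant path will do.
\<close>

lemma C1_orthogonal_path_reflection_pair:
  fixes v w :: "real^'n"
  assumes "v \<noteq> 0" "w \<noteq> 0"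
  shows "\<exists>Q. C1_orthogonal_path Q \<and> Q 0 = mat 1 \<and> Q 1 = reflection v ** reflection w"
proof (cases "\<exists>c. v = c *\<^sub>R w")
  case True
  then obtain c where "v = c *\<^sub>R w" by blast
  with assms have "reflection v = reflection w"
    by (intro matrix_eqI) (simp add: reflection_mult_vec)
  then show ?thesis
    by (intro exI[of _ "\<lambda>_. mat 1"])
      (auto simp: C1_orthogonal_path_def reflection_involution orthogonal_matrix_id)
next
  case False
  define u where "u t = w + t *\<^sub>R (v - w)" for t :: real
  have u0: "u t \<noteq> 0" for t
  proof
    assume "u t = 0"
    then have *: "t *\<^sub>R v = (t - 1) *\<^sub>R w" by (simp add: u_def algebra_simps)
    show False
    proof (cases "t = 0")
      case True with * assms show False by simp
    next
      case False
      with * have "v = ((t - 1) / t) *\<^sub>R w"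
        by (metis divide_inverse_commute scaleR_one scaleR_scaleR left_inverse)
      with \<open>\<nexists>c. v = c *\<^sub>R w\<close> show False by blast
    qed
  qed
  have uC: "u C1_differentiable_on UNIV"
    unfolding u_def C1_differentiable_on_def
    by (intro exI[of _ "\<lambda>_. v - w"]) (auto intro!: derivative_eq_intros)
  obtain D where D: "\<And>t. ((\<lambda>t. u t \<bullet> u t) has_vector_derivative D t) (at t)" "continuous_on UNIV D"
    using C1_differentiable_on_bilinear[OF bounded_bilinear_inner uC uC]
    unfolding C1_differentiable_on_def by auto
  have uu: "continuous_on UNIV (\<lambda>t. u t \<bullet> u t)"
    using uC by (intro continuous_intros C1_differentiable_imp_continuous_on)
  have "(\<lambda>t. 2 / (u t \<bullet> u t)) C1_differentiable_on UNIV"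
    unfolding C1_differentiable_on_def
  proof (intro exI conjI ballI)
    fix t :: real
    show "((\<lambda>t. 2 / (u t \<bullet> u t)) has_vector_derivative - (2 * D t) / ((u t \<bullet> u t) * (u t \<bullet> u t))) (at t)"
      using D(1)[of t] u0[of t] unfolding has_real_derivative_iff_has_vector_derivative[symmetric]
      by (auto intro!: derivative_eq_intros simp: power2_eq_square)
  qed (use u0 D(2) uu in \<open>auto intro!: continuous_intros\<close>)
  then have "(\<lambda>t. reflection (u t)) C1_differentiable_on UNIV"
    unfolding reflection_def
    by (intro C1_differentiable_on_diff C1_differentiable_on_const uC
        C1_differentiable_on_bilinear[OF bounded_bilinear_scaleR]
        C1_differentiable_on_bilinear[OF bounded_bilinear_outer])
  then have "(\<lambda>t. reflection (u t) ** reflection w) C1_differentiable_on UNIV"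
    by (intro C1_differentiable_on_bilinear[OF bounded_bilinear_matrix_mult] C1_differentiable_on_const)
  then show ?thesis
    by (intro exI[of _ "\<lambda>t. reflection (u t) ** reflection w"])
      (auto simp: C1_orthogonal_path_def u_def reflection_involution
        intro!: orthogonal_matrix_mul orthogonal_reflection)
qed

lemma C1_orthogonal_path_reflections:
  fixes vs :: "(real^'n) list"
  assumes "0 \<notin> set vs" "even (length vs)"
  shows "\<exists>Q. C1_orthogonal_path Q \<and> Q 0 = mat 1 \<and> Q 1 = foldr (\<lambda>v B. reflection v ** B) vs (mat 1)"
  using assms
proof (induction vs rule: induct_list012)
  case 1
  then show ?case
    by (intro exI[of _ "\<lambda>_. mat 1"]) (auto simp: C1_orthogonal_path_def orthogonal_matrix_id)
next
  case (3 v w vs)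
  obtain Q where Q: "C1_orthogonal_path Q" "Q 0 = mat 1"
      "Q 1 = foldr (\<lambda>v B. reflection v ** B) vs (mat 1)"
    using 3 by auto
  obtain R where R: "C1_orthogonal_path R" "R 0 = mat 1" "R 1 = reflection v ** reflection w"
    using C1_orthogonal_path_reflection_pair[of v w] "3.prems" by auto
  show ?case
    using Q R by (intro exI[of _ "\<lambda>t. R t ** Q t"])
      (auto simp: C1_orthogonal_path_def matrix_mul_assoc
        intro!: C1_differentiable_on_bilinear[OF bounded_bilinear_matrix_mult] orthogonal_matrix_mul)
qed auto

text \<open>
  A product of \<open>m\<close> reflections has determinant \<open>(-1)\<^sup>m\<close>, so a matrix of determinant \<open>1\<close> is a product
  of an even number of them, and these can be joined to the identity in pairs.
\<close>

lemma C1_orthogonal_path_special_orthogonal: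
  fixes A :: "real^'n^'n"
  assumes "A \<in> special_orthogonal"
  shows "\<exists>Q. C1_orthogonal_path Q \<and> Q 0 = mat 1 \<and> Q 1 = A"
proof -
  obtain vs where vs: "0 \<notin> set vs" "A = foldr (\<lambda>v B. reflection v ** B) vs (mat 1)"
    using assms orthogonal_matrix_product_of_reflections[of A] by (auto simp: special_orthogonal_def)
  have "det (foldr (\<lambda>v B. reflection v ** B) vs (mat 1 :: real^'n^'n)) = (- 1) ^ length vs"
    using vs(1) by (induction vs) (auto simp: det_mul det_reflection)
  with assms vs(2) have "even (length vs)"
    by (auto simp: special_orthogonal_def minus_one_power_iff split: if_splits)
  then show ?thesis
    using C1_orthogonal_path_reflections vs by blast
qed

section \<open>Volume preservation over an arbitrary finite index type\<close>

text \<open>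
  The change of variables formula for the measure of a differentiable image is stated for
  \<open>real^'m\<close> with a well-ordered index type \<open>'m\<close>, while an arbitrary finite type carries no
  canonical order. The copy \<open>'a ranked\<close> of \<open>'a\<close> is well-ordered by an enumeration, and relabelling
  the coordinates transports measures from one index type to the other.
\<close>

typedef 'a ranked = "UNIV :: 'a set" ..

instance ranked :: (finite) finite
proof
  have "(UNIV :: 'a ranked set) = Abs_ranked ` UNIV"
    by (metis Rep_ranked_inverse surjI)
  then show "finite (UNIV :: 'a ranked set)" by (metis finite finite_imageI)
qed

instantiation ranked :: (finite) wellorder
begin
definition less_eq_ranked :: "'a ranked \<Rightarrow> 'a ranked \<Rightarrow> bool" where
  "x \<le> y \<longleftrightarrow> to_nat (Rep_ranked x) \<le> to_nat (Rep_ranked y)"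
definition less_ranked :: "'a ranked \<Rightarrow> 'a ranked \<Rightarrow> bool" where
  "x < y \<longleftrightarrow> to_nat (Rep_ranked x) < to_nat (Rep_ranked y)"
instance
proof
  fix P and a :: "'a ranked"
  assume "\<And>x :: 'a ranked. (\<And>y. y < x \<Longrightarrow> P y) \<Longrightarrow> P x"
  then show "P a"
    unfolding less_ranked_def by (rule measure_induct_rule)
qed (auto simp: less_eq_ranked_def less_ranked_def Rep_ranked_inject)
end

lemma bij_Rep_ranked: "bij Rep_ranked"
  by (rule bij_betwI[where g = Abs_ranked]) (auto simp: Abs_ranked_inverse Rep_ranked_inverse)

definition relabel :: "('m \<Rightarrow> 'n) \<Rightarrow> real^'n \<Rightarrow> real^'m" where
  "relabel \<sigma> x = (\<chi> i. x $ \<sigma> i)"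

lemma relabel_inv:
  assumes "bij \<sigma>"
  shows "relabel \<sigma> (relabel (inv \<sigma>) y) = y" "relabel (inv \<sigma>) (relabel \<sigma> x) = x"
  using assms by (simp_all add: relabel_def vec_eq_iff bij_is_inj bij_is_surj surj_f_inv_f)

lemma linear_relabel: "linear (relabel \<sigma>)"
  by (auto intro!: linearI simp: relabel_def vec_eq_iff)

lemma inner_relabel:
  assumes "bij \<sigma>"
  shows "relabel \<sigma> x \<bullet> relabel \<sigma> y = x \<bullet> y"
  using sum.reindex_bij_betw[OF assms, of "\<lambda>i. x $ i * y $ i"] by (simp add: inner_vec_def relabel_def)

lemma relabel_cbox:
  assumes "bij \<sigma>"
  shows "relabel \<sigma> ` cbox a b = cbox (relabel \<sigma> a) (relabel \<sigma> b)"
proof -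
  have "relabel \<sigma> x \<in> cbox (relabel \<sigma> a) (relabel \<sigma> b) \<longleftrightarrow> x \<in> cbox a b" for x
    using bij_is_surj[OF assms] unfolding mem_box_cart relabel_def vec_lambda_beta by (metis surjD)
  then show ?thesis
    using relabel_inv(1)[OF assms] by (metis (no_types, lifting) image_eqI image_subsetI subsetI subset_antisym)
qed

lemma content_relabel_cbox:
  assumes "bij \<sigma>"
  shows "measure lborel (cbox (relabel \<sigma> a) (relabel \<sigma> b)) = measure lborel (cbox a b)"
proof (cases "cbox a b = {}")
  case True
  then show ?thesis using relabel_cbox[OF assms, of a b] by simp
next
  case False
  then have "cbox (relabel \<sigma> a) (relabel \<sigma> b) \<noteq> {}"
    using relabel_cbox[OF assms, of a b] by auto
  with False show ?thesis
    using prod.reindex_bij_betw[OF assms, of "\<lambda>i. b $ i - a $ i"]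
    by (simp add: content_cbox_cart relabel_def)
qed

text \<open>
  Relabelling maps boxes to boxes with the same side lengths, so it preserves integrals of
  indicator functions.
\<close>

lemma measure_relabel:
  fixes \<sigma> :: "'m::finite \<Rightarrow> 'n::finite"
  assumes \<sigma>: "bij \<sigma>" and S: "S \<in> lmeasurable" "bounded S"
  shows "relabel \<sigma> ` S \<in> lmeasurable" "measure lebesgue (relabel \<sigma> ` S) = measure lebesgue S"
proof -
  obtain a b where ab: "S \<subseteq> cbox a b"
    using bounded_subset_cbox_symmetric S(2) by blast
  have S_eq: "(\<lambda>x. if x \<in> cbox a b then indicat_real S x else 0) = indicat_real S"
    using ab by (auto simp: indicator_def fun_eq_iff)
  have "(indicat_real S has_integral measure lebesgue S) UNIV"
    using S(1) lmeasurable_iff_indicator_has_integral by blast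
  then have "(indicat_real S has_integral measure lebesgue S) (cbox a b)"
    using has_integral_restrict_UNIV[of "cbox a b" "indicat_real S"] S_eq by simp
  then have "((\<lambda>y. indicat_real S (relabel (inv \<sigma>) y)) has_integral (1 / 1) *\<^sub>R measure lebesgue S)
      (relabel \<sigma> ` cbox a b)"
    using \<sigma> bij_imp_bij_inv[OF \<sigma>]
    by (intro has_integral_twiddle)
      (auto simp: relabel_inv relabel_cbox content_relabel_cbox inv_inv_eq
        intro!: linear_continuous_at linear_relabel linear_conv_bounded_linear[THEN iffD1])
  moreover have "indicat_real S (relabel (inv \<sigma>) y) = indicat_real (relabel \<sigma> ` S) y" for y
    using relabel_inv[OF \<sigma>] by (auto simp: indicator_def image_iff)
  ultimately have "(indicat_real (relabel \<sigma> ` S) has_integral measure lebesgue S) (relabel \<sigma> ` cbox a b)"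
    by simp
  then have "(indicat_real (relabel \<sigma> ` S) has_integral measure lebesgue S) UNIV"
    by (rule has_integral_on_superset) (use ab in \<open>auto simp: indicator_def\<close>)
  then show "relabel \<sigma> ` S \<in> lmeasurable" "measure lebesgue (relabel \<sigma> ` S) = measure lebesgue S"
    using lmeasurable_iff_indicator_has_integral by metis+
qed

text \<open>
  The linear maps that arise as derivatives of twists: a shear \<open>h \<mapsto> h + (y \<bullet> h) w\<close> along
  a vector \<open>w\<close> orthogonal to \<open>y\<close>, followed by an orthogonal map. The form is coordinate-free, so
  that it survives a relabelling of the coordinates, which a determinant does only after
  an argument on permutations.
\<close>

definition rotated_shear :: "('a::euclidean_space \<Rightarrow> 'a) \<Rightarrow> bool" where
  "rotated_shear L \<longleftrightarrow>
     (\<exists>U w y. orthogonal_transformation U \<and> w \<bullet> y = 0 \<and> L = (\<lambda>h. U (h + (y \<bullet> h) *\<^sub>R w)))"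

lemma abs_det_rotated_shear:
  fixes L :: "real^'n \<Rightarrow> real^'n"
  assumes "rotated_shear L"
  shows "\<bar>det (matrix L)\<bar> = 1"
proof -
  obtain U w y where U: "orthogonal_transformation U" and wy: "w \<bullet> y = 0"
      and L: "L = (\<lambda>h. U (h + (y \<bullet> h) *\<^sub>R w))"
    using assms rotated_shear_def by blast
  have lin: "linear U" using U orthogonal_transformation_linear by blast
  have "L h = (matrix U ** (mat 1 + outer w y)) *v h" for h
    by (simp add: L matrix_vector_mul_assoc[symmetric] matrix_vector_mult_add_rdistrib
        outer_mult_vec lin)
  then have "matrix L = matrix U ** (mat 1 + outer w y)"
    by (metis matrix_of_matrix_vector_mul ext)
  moreover have "\<bar>det (matrix U)\<bar> = 1"
    using U by (rule orthogonal_transformation_det)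
  ultimately show ?thesis
    by (simp add: det_mul abs_mult det_mat1_plus_outer wy)
qed

lemma rotated_shear_relabel:
  fixes \<sigma> :: "'m::finite \<Rightarrow> 'n::finite"
  assumes \<sigma>: "bij \<sigma>" and L: "rotated_shear L"
  shows "rotated_shear (\<lambda>h. relabel \<sigma> (L (relabel (inv \<sigma>) h)))"
proof -
  obtain U w y where U: "orthogonal_transformation U" and wy: "w \<bullet> y = 0"
      and L: "L = (\<lambda>h. U (h + (y \<bullet> h) *\<^sub>R w))"
    using assms rotated_shear_def by blast
  interpret R: linear "relabel \<sigma> :: real^'n \<Rightarrow> real^'m" by (rule linear_relabel)
  interpret I: linear "relabel (inv \<sigma>) :: real^'m \<Rightarrow> real^'n" by (rule linear_relabel)
  note inv = relabel_inv[OF \<sigma>]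
  note inn = inner_relabel[OF \<sigma>] inner_relabel[OF bij_imp_bij_inv[OF \<sigma>]]
  let ?U = "\<lambda>h. relabel \<sigma> (U (relabel (inv \<sigma>) h))"
  have "orthogonal_transformation ?U"
    using U orthogonal_transformation_linear[OF U] unfolding orthogonal_transformation_def
    by (auto simp: inn intro!: linear_compose[OF _ linear_relabel, unfolded o_def]
        linear_compose[OF linear_relabel, unfolded o_def])
  moreover have "relabel \<sigma> w \<bullet> relabel \<sigma> y = 0" by (simp add: inn wy)
  moreover have "y \<bullet> relabel (inv \<sigma>) h = relabel \<sigma> y \<bullet> h" for h
    by (metis inn(1) inv(1))
  then have "(\<lambda>h. relabel \<sigma> (L (relabel (inv \<sigma>) h)))
      = (\<lambda>h. ?U (h + (relabel \<sigma> y \<bullet> h) *\<^sub>R relabel \<sigma> w))"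
    by (simp add: L I.add I.scaleR inv)
  ultimately show ?thesis unfolding rotated_shear_def by blast
qed

text \<open>
  After relabelling the coordinates by a well-ordered index type, this is the change of
  variables formula with Jacobian determinant \<open>\<plusminus>1\<close>.
\<close>

lemma measure_image_rotated_shear:
  fixes f :: "real^'n \<Rightarrow> real^'n"
  assumes f': "\<And>x. (f has_derivative f' x) (at x)" and shear: "\<And>x. rotated_shear (f' x)"
    and "inj f" and S: "S \<in> lmeasurable" "bounded S"
  shows "f ` S \<in> lmeasurable" "measure lebesgue (f ` S) = measure lebesgue S"
proof -
  define \<sigma> where "\<sigma> = (Rep_ranked :: 'n ranked \<Rightarrow> 'n)"
  have \<sigma>: "bij \<sigma>" by (simp add: \<sigma>_def bij_Rep_ranked)
  note \<sigma>' = bij_imp_bij_inv[OF \<sigma>] and inv = relabel_inv[OF \<sigma>]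
  define F where "F y = relabel \<sigma> (f (relabel (inv \<sigma>) y))" for y
  define F' where "F' y h = relabel \<sigma> (f' (relabel (inv \<sigma>) y) (relabel (inv \<sigma>) h))" for y h
  let ?T = "relabel \<sigma> ` S"
  have T: "?T \<in> lmeasurable" "measure lebesgue ?T = measure lebesgue S"
    using measure_relabel[OF \<sigma> S] by auto
  have F'F: "(F has_derivative F' y) (at y within ?T)" for y
    unfolding F_def F'_def
    by (intro has_derivative_compose[OF _ linear_imp_has_derivative[OF linear_relabel]]
        has_derivative_compose[OF linear_imp_has_derivative[OF linear_relabel] f'])
  have injF: "inj F"
    using \<open>inj f\<close> inv unfolding inj_def F_def by metis
  have "\<bar>det (matrix (F' y))\<bar> = 1" for y
    unfolding F'_def by (intro abs_det_rotated_shear rotated_shear_relabel \<sigma> shear)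
  then have "F ` ?T \<in> lmeasurable \<and> measure lebesgue (F ` ?T) = measure lebesgue ?T"
    using has_measure_differentiable_image[of ?T F F' "measure lebesgue ?T"] T(1) F'F injF
    by (simp add: has_integral_iff lmeasure_integral integrable_on_const fmeasurableD
        inj_on_subset[OF injF])
  moreover have "F ` ?T = relabel \<sigma> ` f ` S"
    by (simp add: F_def image_image inv)
  moreover have "continuous_on (closure S) f"
    using f' by (intro continuous_at_imp_continuous_on) (blast intro: has_derivative_continuous)
  then have "bounded (f ` S)"
    using S(2) by (meson bounded_subset closure_subset compact_closure compact_continuous_image
        compact_imp_bounded image_mono)
  ultimately have "relabel (inv \<sigma>) ` relabel \<sigma> ` f ` S \<in> lmeasurable"
    "measure lebesgue (relabel (inv \<sigma>) ` relabel \<sigma> ` f ` S) = measure lebesgue S"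
    using T(2) measure_relabel[OF \<sigma>', of "relabel \<sigma> ` f ` S"]
    by (auto simp: bounded_linear_image linear_linear linear_relabel)
  then show "f ` S \<in> lmeasurable" "measure lebesgue (f ` S) = measure lebesgue S"
    by (simp_all add: image_image inv)
qed

section \<open>Twists of a ball\<close>

text \<open>
  A profile assigns an orthogonal matrix to each squared distance from the centre of a ball of
  squared radius \<open>\<rho>\<close>; from the boundary sphere onwards it is the identity.
\<close>

definition rotation_profile :: "real \<Rightarrow> (real \<Rightarrow> real^'n^'n) \<Rightarrow> bool" where
  "rotation_profile \<rho> Q \<longleftrightarrow> C1_orthogonal_path Q \<and> (\<forall>t\<ge>\<rho>. Q t = mat 1)"

text \<open>
  Rotation of each sphere around \<open>c\<close> by its own orthogonal matrix. Indexing the matrices by the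
  square of the distance makes the map differentiable also at \<open>c\<close>.
\<close>

definition twist :: "real^'n \<Rightarrow> (real \<Rightarrow> real^'n^'n) \<Rightarrow> real^'n \<Rightarrow> real^'n" where
  "twist c Q x = c + Q ((x - c) \<bullet> (x - c)) *v (x - c)"

definition twist_jacobian :: "real^'n \<Rightarrow> (real \<Rightarrow> real^'n^'n) \<Rightarrow> real^'n \<Rightarrow> real^'n^'n" where
  "twist_jacobian c Q x = (let y = x - c; s = y \<bullet> y in
     Q s + 2 *\<^sub>R outer (vector_derivative Q (at s) *v y) y)"

lemma C1_orthogonal_pathD:
  assumes "C1_orthogonal_path Q"
  shows "orthogonal_matrix (Q t)"
    and "(Q has_vector_derivative vector_derivative Q (at t)) (at t)"
    and "continuous_on UNIV Q"
    and "continuous_on UNIV (\<lambda>t. vector_derivative Q (at t))"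
  using assms unfolding C1_orthogonal_path_def C1_differentiable_on_eq
  by (auto simp: vector_derivative_works intro!: differentiable_imp_continuous_on
      differentiable_at_imp_differentiable_on)

text \<open>
  The curve \<open>Q t *v y\<close> stays on a sphere, so its velocity is orthogonal to its position.
\<close>

lemma orthogonal_path_derivative_orthogonal:
  assumes "C1_orthogonal_path Q"
  shows "(vector_derivative Q (at t) *v y) \<bullet> (Q t *v y) = 0"
proof -
  have Q': "((\<lambda>t. Q t *v y) has_vector_derivative vector_derivative Q (at t) *v y) (at t)"
    using bounded_bilinear.has_vector_derivative[OF bounded_bilinear_matrix_vector_mult
        C1_orthogonal_pathD(2)[OF assms] has_vector_derivative_const] by simp
  have "((\<lambda>t. (Q t *v y) \<bullet> (Q t *v y)) has_vector_derivative
      2 * ((vector_derivative Q (at t) *v y) \<bullet> (Q t *v y))) (at t)"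
    using bounded_bilinear.has_vector_derivative[OF bounded_bilinear_inner Q' Q']
    by (simp add: inner_commute)
  moreover have "(\<lambda>t. (Q t *v y) \<bullet> (Q t *v y)) = (\<lambda>_. y \<bullet> y)"
    using C1_orthogonal_pathD(1)[OF assms] by (simp add: orthogonal_matrix_iff_inner)
  ultimately have "2 * ((vector_derivative Q (at t) *v y) \<bullet> (Q t *v y)) = 0"
    by (metis has_vector_derivative_const vector_derivative_unique_at)
  then show ?thesis by simp
qed

lemma vector_derivative_locally_constant:
  assumes "open S" "t \<in> S" "\<And>s. s \<in> S \<Longrightarrow> Q s = A"
  shows "vector_derivative Q (at t) = 0"
  using assms has_vector_derivative_transform_within_open[OF has_vector_derivative_const, of S t A Q]
  by (auto intro: vector_derivative_at)

text \<open>
  Beyond \<open>\<rho>\<close> the profile is locally constant; at \<open>\<rho>\<close> itself the derivative vanishes because it is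
  continuous.
\<close>

lemma rotation_profile_derivative_0:
  assumes "rotation_profile \<rho> Q" "t \<ge> \<rho>"
  shows "vector_derivative Q (at t) = 0"
proof -
  let ?D = "\<lambda>t. vector_derivative Q (at t)"
  have "?D s = 0" if "s > \<rho>" for s
    using assms(1) that unfolding rotation_profile_def
    by (intro vector_derivative_locally_constant[of "{\<rho><..}"]) auto
  moreover have "continuous_on UNIV ?D"
    using assms(1) C1_orthogonal_pathD(4) rotation_profile_def by blast
  then have "closed {s. ?D s = 0}"
    by (intro closed_Collect_eq continuous_on_const)
  ultimately have "closure {\<rho><..} \<subseteq> {s. ?D s = 0}"
    by (intro closure_minimal) auto
  then show ?thesis using assms(2) by auto
qed

lemma rotation_profile_transpose:
  fixes Q :: "real \<Rightarrow> real^'n^'n"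
  assumes "rotation_profile \<rho> Q"
  shows "rotation_profile \<rho> (\<lambda>t. transpose (Q t))"
proof -
  have bl: "bounded_linear (transpose :: real^'n^'n \<Rightarrow> _)"
    by (intro linear_conv_bounded_linear[THEN iffD1] linearI)
      (auto simp: transpose_def vec_eq_iff)
  obtain D where D: "\<And>t. (Q has_vector_derivative D t) (at t)" "continuous_on UNIV D"
    using assms unfolding rotation_profile_def C1_orthogonal_path_def C1_differentiable_on_def by auto
  have "(\<lambda>t. transpose (Q t)) C1_differentiable_on UNIV"
    unfolding C1_differentiable_on_def
    using bounded_linear.has_vector_derivative[OF bl D(1)] bounded_linear.continuous_on[OF bl D(2)]
    by (intro exI[of _ "\<lambda>t. transpose (D t)"]) auto
  with assms show ?thesis
    by (simp add: rotation_profile_def C1_orthogonal_path_def)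
qed

lemma has_derivative_twist:
  assumes "C1_orthogonal_path Q"
  shows "(twist c Q has_derivative (\<lambda>h. twist_jacobian c Q x *v h)) (at x)"
proof -
  let ?y = "x - c"
  let ?s = "?y \<bullet> ?y"
  let ?Q' = "vector_derivative Q (at ?s)"
  have y: "((\<lambda>x. x - c) has_derivative (\<lambda>h. h)) (at x)"
    by (auto intro!: derivative_eq_intros)
  have s: "((\<lambda>x. (x - c) \<bullet> (x - c)) has_derivative (\<lambda>h. 2 * (?y \<bullet> h))) (at x)"
    by (auto intro!: derivative_eq_intros simp: inner_commute)
  have "(Q has_derivative (\<lambda>t. t *\<^sub>R ?Q')) (at ?s)"
    using C1_orthogonal_pathD(2)[OF assms] unfolding has_vector_derivative_def .
  from has_derivative_compose[OF s this]
  have "((\<lambda>x. Q ((x - c) \<bullet> (x - c))) has_derivative (\<lambda>h. (2 * (?y \<bullet> h)) *\<^sub>R ?Q')) (at x)" .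
  from bounded_bilinear.FDERIV[OF bounded_bilinear_matrix_vector_mult this y]
  have "((\<lambda>x. Q ((x - c) \<bullet> (x - c)) *v (x - c)) has_derivative
      (\<lambda>h. Q ?s *v h + ((2 * (?y \<bullet> h)) *\<^sub>R ?Q') *v ?y)) (at x)" .
  from has_derivative_add[OF has_derivative_const[of c] this]
  show ?thesis
    unfolding twist_def twist_jacobian_def Let_def
    by (simp add: matrix_vector_mult_add_rdistrib outer_mult_vec scaleR_matrix_vector_assoc[symmetric])
qed

lemma continuous_on_twist_jacobian:
  assumes "C1_orthogonal_path Q"
  shows "continuous_on UNIV (twist_jacobian c Q)"
proof -
  have s: "continuous_on UNIV (\<lambda>x. (x - c) \<bullet> (x - c))" by (intro continuous_intros)
  note * = C1_orthogonal_pathD(3,4)[OF assms, THEN continuous_on_compose2, OF s, simplified]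
  show ?thesis
    unfolding twist_jacobian_def Let_def
    by (intro continuous_intros * bounded_bilinear.continuous_on[OF bounded_bilinear_outer]
        bounded_bilinear.continuous_on[OF bounded_bilinear_matrix_vector_mult])
qed

text \<open>
  The derivative of the twist is \<open>Q\<close> composed with the shear along \<open>w = 2 Q\<^sup>T Q' y\<close>, and
  \<open>w \<bullet> y = 2 (Q' y) \<bullet> (Q y) = 0\<close>.
\<close>

lemma rotated_shear_twist_jacobian:
  assumes "C1_orthogonal_path Q"
  shows "rotated_shear (\<lambda>h. twist_jacobian c Q x *v h)"
proof -
  let ?y = "x - c"
  let ?s = "?y \<bullet> ?y"
  let ?Q' = "vector_derivative Q (at ?s)"
  let ?w = "2 *\<^sub>R (transpose (Q ?s) *v (?Q' *v ?y))"
  note orth = C1_orthogonal_pathD(1)[OF assms, of ?s]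
  have "orthogonal_transformation (\<lambda>h. Q ?s *v h)"
    using orth by (simp add: orthogonal_transformation_def orthogonal_matrix_iff_inner)
  moreover have "Q ?s *v ?w = 2 *\<^sub>R (?Q' *v ?y)"
    using orth by (simp add: matrix_vector_mult_scaleR matrix_vector_mul_assoc matrix_mul_assoc
        orthogonal_matrix_def)
  moreover from this have "?w \<bullet> ?y = 0"
    using orthogonal_path_derivative_orthogonal[OF assms, of ?s ?y] orth
    by (metis inner_scaleR_left mult_zero_right orthogonal_matrix_iff_inner)
  ultimately show ?thesis
    unfolding rotated_shear_def twist_jacobian_def Let_def
    by (intro exI[of _ "\<lambda>h. Q ?s *v h"] exI[of _ ?w] exI[of _ ?y])
      (auto simp: matrix_vector_mult_add_rdistrib outer_mult_vec matrix_vector_right_distrib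
        scaleR_matrix_vector_assoc[symmetric] matrix_vector_mult_scaleR)
qed

lemma twist_outside:
  assumes "rotation_profile (r\<^sup>2) Q" "0 < r" "x \<notin> ball c r"
  shows "twist c Q x = x" "twist_jacobian c Q x = mat 1"
proof -
  have "r\<^sup>2 \<le> (norm (x - c))\<^sup>2"
    using assms(2,3) by (intro power_mono) (auto simp: dist_norm norm_minus_commute)
  then have "r\<^sup>2 \<le> (x - c) \<bullet> (x - c)" by (simp add: power2_norm_eq_inner)
  then show "twist c Q x = x" "twist_jacobian c Q x = mat 1"
    using assms(1) rotation_profile_derivative_0[OF assms(1)]
      bounded_bilinear.zero_left[OF bounded_bilinear_outer]
    by (auto simp: twist_def twist_jacobian_def rotation_profile_def Let_def)
qed

lemma norm_twist:
  assumes "C1_orthogonal_path Q"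
  shows "norm (twist c Q x - c) = norm (x - c)"
  using C1_orthogonal_pathD(1)[OF assms]
  by (simp add: twist_def norm_eq_sqrt_inner orthogonal_matrix_iff_inner)

text \<open>
  Both twists preserve the spheres around \<open>c\<close>, and on each of them they are given by inverse
  matrices.
\<close>

lemma twist_transpose:
  assumes "C1_orthogonal_path Q"
  shows "twist c (\<lambda>t. transpose (Q t)) (twist c Q x) = x"
proof -
  have "(twist c Q x - c) \<bullet> (twist c Q x - c) = (x - c) \<bullet> (x - c)"
    using norm_twist[OF assms] by (metis power2_norm_eq_inner)
  moreover have "transpose (Q t) *v (Q t *v y) = y" for t y
    using C1_orthogonal_pathD(1)[OF assms] by (simp add: matrix_vector_mul_assoc orthogonal_matrix_def)
  ultimately show ?thesis
    unfolding twist_def[of c "\<lambda>t. transpose (Q t)"] by (simp add: twist_def)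
qed

section \<open>Simultaneous twists of disjoint balls\<close>

locale disjoint_twists =
  fixes I :: "'i set" and c :: "'i \<Rightarrow> real^'n" and r :: "'i \<Rightarrow> real"
    and Q :: "'i \<Rightarrow> real \<Rightarrow> real^'n^'n"
  assumes finite_I: "finite I"
    and r_pos: "i \<in> I \<Longrightarrow> 0 < r i"
    and profile: "i \<in> I \<Longrightarrow> rotation_profile ((r i)\<^sup>2) (Q i)"
    and disjoint: "pairwise (\<lambda>i j. disjnt (ball (c i) (r i)) (ball (c j) (r j))) I"
begin

text \<open>
  Writing the map that twists each ball as a sum of displacements, at most one of which is
  nonzero at any point, gives differentiability everywhere without a case distinction at the
  boundaries of the balls.
\<close>

definition glued :: "real^'n \<Rightarrow> real^'n" where
  "glued x = x + (\<Sum>i\<in>I. twist (c i) (Q i) x - x)"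

definition glued_jacobian :: "real^'n \<Rightarrow> real^'n^'n" where
  "glued_jacobian x = mat 1 + (\<Sum>i\<in>I. twist_jacobian (c i) (Q i) x - mat 1)"

lemma path: "i \<in> I \<Longrightarrow> C1_orthogonal_path (Q i)"
  using profile rotation_profile_def by blast

lemma has_derivative_glued: "(glued has_derivative (\<lambda>h. glued_jacobian x *v h)) (at x)"
proof -
  have "(glued has_derivative (\<lambda>h. h + (\<Sum>i\<in>I. twist_jacobian (c i) (Q i) x *v h - h))) (at x)"
    unfolding glued_def
    by (intro has_derivative_add has_derivative_sum has_derivative_diff has_derivative_ident
        has_derivative_twist path)
  moreover have "(\<Sum>i\<in>I. twist_jacobian (c i) (Q i) x - mat 1) *v h
      = (\<Sum>i\<in>I. twist_jacobian (c i) (Q i) x *v h - h)" for h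
    by (simp add: bounded_bilinear.sum_left[OF bounded_bilinear_matrix_vector_mult]
        matrix_vector_mult_diff_rdistrib)
  ultimately show ?thesis
    unfolding glued_jacobian_def by (simp add: matrix_vector_mult_add_rdistrib)
qed

lemma continuous_on_glued_jacobian: "continuous_on UNIV glued_jacobian"
  unfolding glued_jacobian_def
  by (intro continuous_intros continuous_on_twist_jacobian path)

lemma jacobian_glued: "jacobian glued (at x) = glued_jacobian x"
  by (simp add: jacobian_def frechet_derivative_at[OF has_derivative_glued, symmetric])

lemma glued_in_ball:
  assumes k: "k \<in> I" "x \<in> ball (c k) (r k)"
  shows "glued x = twist (c k) (Q k) x" "glued_jacobian x = twist_jacobian (c k) (Q k) x"
    "glued x \<in> ball (c k) (r k)"
proof -
  have "x \<notin> ball (c i) (r i)" if "i \<in> I - {k}" for i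
    using pairwiseD[OF disjoint, of i k] that k by (auto simp: disjnt_iff)
  note out = twist_outside[OF profile r_pos this]
  show 1: "glued x = twist (c k) (Q k) x"
    using finite_I k(1) out by (simp add: glued_def sum.remove)
  show "glued_jacobian x = twist_jacobian (c k) (Q k) x"
    using finite_I k(1) out by (simp add: glued_jacobian_def sum.remove)
  show "glued x \<in> ball (c k) (r k)"
    using norm_twist[OF path[OF k(1)], of "c k" x] k(2)
    by (simp add: 1 dist_norm norm_minus_commute)
qed

lemma glued_outside:
  assumes "\<And>k. k \<in> I \<Longrightarrow> x \<notin> ball (c k) (r k)"
  shows "glued x = x" "glued_jacobian x = mat 1"
  using twist_outside[OF profile r_pos assms] by (simp_all add: glued_def glued_jacobian_def)

lemma rotated_shear_glued_jacobian: "rotated_shear (\<lambda>h. glued_jacobian x *v h)"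
proof (cases "\<exists>k\<in>I. x \<in> ball (c k) (r k)")
  case True
  then show ?thesis
    using glued_in_ball(2) rotated_shear_twist_jacobian path by metis
next
  case False
  then have "(\<lambda>h. glued_jacobian x *v h) = (\<lambda>h. h)"
    using glued_outside(2) by auto
  then show ?thesis
    unfolding rotated_shear_def
    by (intro exI[of _ "\<lambda>h. h"] exI[of _ 0]) (simp add: orthogonal_transformation_id)
qed

lemma glued_image:
  assumes "\<And>k. k \<in> I \<Longrightarrow> ball (c k) (r k) \<subseteq> \<Omega>" "x \<in> \<Omega>"
  shows "glued x \<in> \<Omega>"
  using assms glued_in_ball(3) glued_outside(1) by (cases "\<exists>k\<in>I. x \<in> ball (c k) (r k)") fastforce+

lemma norm_glued_diff:
  assumes "\<And>k. k \<in> I \<Longrightarrow> r k \<le> \<epsilon>" "0 \<le> \<epsilon>"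
  shows "norm (glued x - x) \<le> 2 * \<epsilon>"
proof (cases "\<exists>k\<in>I. x \<in> ball (c k) (r k)")
  case True
  then obtain k where k: "k \<in> I" "x \<in> ball (c k) (r k)" by blast
  then have "dist (glued x) x \<le> 2 * r k"
    using glued_in_ball(3)[OF k] dist_triangle[of "glued x" x "c k"] by (simp add: dist_commute)
  then show ?thesis using assms(1)[OF k(1)] by (simp add: dist_norm)
next
  case False
  then have "glued x = x" by (intro glued_outside) blast
  then show ?thesis using assms(2) by simp
qed

lemma transposed: "disjoint_twists I c r (\<lambda>i t. transpose (Q i t))"
  by unfold_locales (auto intro: finite_I r_pos disjoint rotation_profile_transpose profile)

text \<open>
  The inverse of the glued map is glued from the inverse twists, so every property of glued
  maps also holds for the inverse.
\<close>

lemma glued_transposed_glued: "disjoint_twists.glued I c (\<lambda>i t. transpose (Q i t)) (glued x) = x"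
proof -
  interpret inv: disjoint_twists I c r "\<lambda>i t. transpose (Q i t)" by (rule transposed)
  show ?thesis
  proof (cases "\<exists>k\<in>I. x \<in> ball (c k) (r k)")
    case True
    then obtain k where k: "k \<in> I" "x \<in> ball (c k) (r k)" by blast
    then show ?thesis
      using inv.glued_in_ball(1)[OF k(1) glued_in_ball(3)[OF k]] glued_in_ball(1)[OF k]
        twist_transpose path by metis
  next
    case False
    then show ?thesis using glued_outside(1) inv.glued_outside(1) by auto
  qed
qed

text \<open>
  The glued map and its inverse are both \<open>C\<^sup>1\<close> maps of the whole space that map \<open>\<Omega>\<close> into itself,
  hence a homeomorphism of \<open>\<Omega>\<close>. Preimages are images under the inverse map, whose derivatives
  are rotated shears, so measure is preserved.
\<close>

lemma glued_admissible:
  assumes \<Omega>: "bounded \<Omega>" "open \<Omega>" and sub: "\<And>k. k \<in> I \<Longrightarrow> ball (c k) (r k) \<subseteq> \<Omega>"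
  shows "glued \<in> admissible_maps \<Omega>"
proof -
  interpret inv: disjoint_twists I c r "\<lambda>i t. transpose (Q i t)" by (rule transposed)
  have gf: "inv.glued (glued x) = x" for x by (rule glued_transposed_glued)
  have fg: "glued (inv.glued x) = x" for x using inv.glued_transposed_glued by simp
  have cont: "continuous_on S glued" "continuous_on S inv.glued" for S
    using has_derivative_continuous[OF has_derivative_glued]
      has_derivative_continuous[OF inv.has_derivative_glued]
    by (auto intro: continuous_at_imp_continuous_on)
  have hom: "homeomorphism \<Omega> \<Omega> glued inv.glued"
    using glued_image[OF sub] inv.glued_image[OF sub] gf fg
    by (intro homeomorphismI cont) auto
  have C1: "C1_on \<Omega> glued"
    unfolding C1_on_def jacobian_glued
    using has_derivative_glued continuous_on_glued_jacobian
    by (auto simp: differentiable_def intro: continuous_on_subset)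
  have \<Omega>_leb: "\<Omega> \<in> sets lebesgue" "\<Omega> \<in> lmeasurable"
    using \<Omega> by (auto simp: lmeasurable_open)
  have inj: "inj inv.glued" using fg by (metis injI)
  have preimage: "glued -` A \<inter> \<Omega> \<in> lmeasurable"
      "measure lebesgue (glued -` A \<inter> \<Omega>) = measure lebesgue A" "A \<in> lmeasurable"
    if A: "A \<in> sets (lebesgue_on \<Omega>)" for A
  proof -
    have sub\<Omega>: "A \<subseteq> \<Omega>" and "A \<in> sets lebesgue"
      using A \<Omega>_leb(1) by (auto simp: sets_restrict_space_iff)
    then show A': "A \<in> lmeasurable"
      using \<Omega>(1) bounded_set_imp_lmeasurable bounded_subset by blast
    have "glued -` A \<inter> \<Omega> = inv.glued ` A"
    proof
      show "glued -` A \<inter> \<Omega> \<subseteq> inv.glued ` A" by (auto, metis gf image_eqI)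
      show "inv.glued ` A \<subseteq> glued -` A \<inter> \<Omega>" using fg inv.glued_image[OF sub] sub\<Omega> by auto
    qed
    then show "glued -` A \<inter> \<Omega> \<in> lmeasurable"
      "measure lebesgue (glued -` A \<inter> \<Omega>) = measure lebesgue A"
      using measure_image_rotated_shear[OF inv.has_derivative_glued
          inv.rotated_shear_glued_jacobian inj A'] bounded_subset[OF \<Omega>(1) sub\<Omega>] by auto
  qed
  have meas: "glued \<in> lebesgue_on \<Omega> \<rightarrow>\<^sub>M lebesgue_on \<Omega>"
    using glued_image[OF sub] preimage(1) \<Omega>_leb
    by (intro measurableI) (auto simp: sets_restrict_space_iff fmeasurableD)
  have "distr (lebesgue_on \<Omega>) (lebesgue_on \<Omega>) glued = lebesgue_on \<Omega>"
  proof (rule measure_eqI)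
    fix A assume "A \<in> sets (distr (lebesgue_on \<Omega>) (lebesgue_on \<Omega>) glued)"
    then have A: "A \<in> sets (lebesgue_on \<Omega>)" by simp
    have "emeasure (lebesgue_on \<Omega>) (glued -` A \<inter> \<Omega>) = emeasure lebesgue (glued -` A \<inter> \<Omega>)"
      using \<Omega>_leb by (intro emeasure_restrict_space) auto
    also have "\<dots> = emeasure lebesgue A"
      using preimage[OF A] by (simp add: emeasure_eq_measure2)
    also have "\<dots> = emeasure (lebesgue_on \<Omega>) A"
      using \<Omega>_leb A by (intro emeasure_restrict_space[symmetric]) (auto simp: sets_restrict_space_iff)
    finally show "emeasure (distr (lebesgue_on \<Omega>) (lebesgue_on \<Omega>) glued) A = emeasure (lebesgue_on \<Omega>) A"
      by (simp add: emeasure_distr[OF meas A])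
  qed simp
  with meas have "volume_preserving_on \<Omega> glued"
    by (simp add: volume_preserving_on_def)
  moreover have "continuous_to_boundary \<Omega> glued"
    unfolding continuous_to_boundary_def using cont(1) by blast
  ultimately show ?thesis
    using hom C1 by (auto simp: admissible_maps_def)
qed

end

section \<open>Twists that are rigid outside a thin shell\<close>

lemma square_positive_part_has_derivative:
  "((\<lambda>t::real. (max 0 t)\<^sup>2) has_real_derivative 2 * max 0 t) (at t)"
proof -
  consider "t < 0" | "t = 0" | "t > 0" by linarith
  then show ?thesis
  proof cases
    case 1
    then have "((\<lambda>_. 0) has_real_derivative 2 * max 0 t) (at t)" by simp
    then show ?thesis
      by (rule has_field_derivative_transform_within_open[of _ _ _ "{..<0}"]) (use 1 in auto)
  next
    case 2
    have "(\<lambda>h::real. (max 0 h)\<^sup>2 / h) \<midarrow>0\<rightarrow> 0"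
    proof (rule Lim_null_comparison)
      show "\<forall>\<^sub>F h in at 0. norm ((max 0 h)\<^sup>2 / h) \<le> \<bar>h\<bar>"
        by (rule always_eventually) (auto simp: max_def power2_eq_square)
      show "(\<lambda>h::real. \<bar>h\<bar>) \<midarrow>0\<rightarrow> 0" using tendsto_rabs_zero[OF tendsto_ident_at] .
    qed
    with 2 show ?thesis by (simp add: DERIV_def)
  next
    case 3
    then have "((\<lambda>t. t\<^sup>2) has_real_derivative 2 * max 0 t) (at t)"
      by (auto intro!: derivative_eq_intros)
    then show ?thesis
      by (rule has_field_derivative_transform_within_open[of _ _ _ "{0<..}"]) (use 3 in auto)
  qed
qed

text \<open>
  A quadratic spline with knots \<open>0\<close>, \<open>1/2\<close>, \<open>1\<close>.
\<close>

lemma C1_step_function: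
  obtains \<phi> \<phi>' :: "real \<Rightarrow> real"
  where "\<And>t. (\<phi> has_real_derivative \<phi>' t) (at t)" "continuous_on UNIV \<phi>'"
    "\<And>t. t \<le> 0 \<Longrightarrow> \<phi> t = 0" "\<And>t. 1 \<le> t \<Longrightarrow> \<phi> t = 1"
proof
  let ?q = "\<lambda>t::real. (max 0 t)\<^sup>2"
  let ?\<phi> = "\<lambda>t. 2 * ?q t - 4 * ?q (t - 1 / 2) + 2 * ?q (t - 1)"
  let ?\<phi>' = "\<lambda>t::real. 4 * max 0 t - 8 * max 0 (t - 1 / 2) + 4 * max 0 (t - 1)"
  have shift: "((\<lambda>t. ?q (t - a)) has_real_derivative 2 * max 0 (t - a)) (at t)" for a t
    using square_positive_part_has_derivative[of "t - a"] DERIV_shift[of ?q _ t "- a"] by simp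
  show "(?\<phi> has_real_derivative ?\<phi>' t) (at t)" for t
    by (rule derivative_eq_intros square_positive_part_has_derivative shift refl)+ simp
  show "continuous_on UNIV ?\<phi>'" by (intro continuous_intros)
  show "?\<phi> t = 0" if "t \<le> 0" for t using that by (simp add: max_def)
  show "?\<phi> t = 1" if "1 \<le> t" for t
    using that by (simp add: max_def power2_eq_square field_simps)
qed

lemma C1_orthogonal_path_compose:
  assumes P: "C1_orthogonal_path P"
    and \<phi>: "\<And>t. (\<phi> has_real_derivative \<phi>' t) (at t)" "continuous_on UNIV \<phi>'"
  shows "C1_orthogonal_path (\<lambda>t. P (\<phi> t))"
    and "vector_derivative (\<lambda>t. P (\<phi> t)) (at t) = \<phi>' t *\<^sub>R vector_derivative P (at (\<phi> t))"
proof -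
  have D: "((\<lambda>t. P (\<phi> t)) has_vector_derivative \<phi>' t *\<^sub>R vector_derivative P (at (\<phi> t))) (at t)" for t
    using vector_diff_chain_at[of \<phi> "\<phi>' t" t P] \<phi>(1) C1_orthogonal_pathD(2)[OF P]
    by (simp add: o_def has_real_derivative_iff_has_vector_derivative)
  have "continuous_on UNIV \<phi>"
    using \<phi>(1) by (intro continuous_at_imp_continuous_on) (blast intro: DERIV_isCont)
  then have "continuous_on UNIV (\<lambda>t. \<phi>' t *\<^sub>R vector_derivative P (at (\<phi> t)))"
    by (intro continuous_intros \<phi>(2) continuous_on_compose2[OF C1_orthogonal_pathD(4)[OF P]]) auto
  then show "C1_orthogonal_path (\<lambda>t. P (\<phi> t))"
    using D C1_orthogonal_pathD(1)[OF P]
    unfolding C1_orthogonal_path_def C1_differentiable_on_def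
    by (intro conjI exI[of _ "\<lambda>t. \<phi>' t *\<^sub>R vector_derivative P (at (\<phi> t))"]) auto
  show "vector_derivative (\<lambda>t. P (\<phi> t)) (at t) = \<phi>' t *\<^sub>R vector_derivative P (at (\<phi> t))"
    using D by (rule vector_derivative_at)
qed

lemma orthogonal_matrix_entry_le_1:
  fixes A :: "real^'n^'n"
  assumes "orthogonal_matrix A"
  shows "\<bar>A $ i $ j\<bar> \<le> 1"
proof -
  have "norm (column j A) = 1" using assms orthogonal_matrix_orthonormal_columns by blast
  then show ?thesis using component_le_norm_cart[of "column j A" i] by (simp add: column_def)
qed

text \<open>
  The profile equals \<open>A\<close> on the core of radius \<open>\<sigma> r\<close> and turns \<open>A\<close> into the identity within the shell
  of relative thickness \<open>\<delta> = 1 - \<sigma>\<close>. There the derivative of the twist is bounded by a constant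
  times \<open>1/\<delta>\<close>, whereas the shell occupies a fraction at most \<open>d \<delta>\<close> of the ball, \<open>d\<close> being the dimension. So the \<open>p\<close>-th power
  of the derivative contributes at most a constant times \<open>\<delta> powr (1 - p)\<close>, which is small because
  \<open>p < 1\<close>. The factor \<open>M + 1\<close> leaves room for subtracting a matrix with entries bounded by \<open>1\<close>.
\<close>

lemma thin_shell_profile:
  fixes A :: "real^'n^'n"
  assumes A: "A \<in> special_orthogonal" and p: "0 < p" "p < 1" and "0 < r" "0 < \<eta>"
  shows "\<exists>Q \<sigma> M. rotation_profile (r\<^sup>2) Q \<and> 0 < \<sigma> \<and> \<sigma> < 1 \<and> 0 \<le> M \<and>
    (\<forall>c. \<forall>x\<in>ball c (\<sigma> * r). twist_jacobian c Q x = A) \<and>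
    (\<forall>c. \<forall>x\<in>ball c r. \<forall>i j. \<bar>twist_jacobian c Q x $ i $ j\<bar> \<le> M) \<and>
    (M + 1) powr p * (1 - \<sigma> ^ CARD('n)) \<le> \<eta>"
proof -
  obtain P where P: "C1_orthogonal_path P" "P 0 = mat 1" "P 1 = A"
    using C1_orthogonal_path_special_orthogonal[OF A] by blast
  obtain \<phi> \<phi>' :: "real \<Rightarrow> real" where \<phi>: "\<And>t. (\<phi> has_real_derivative \<phi>' t) (at t)" "continuous_on UNIV \<phi>'"
    "\<And>t. t \<le> 0 \<Longrightarrow> \<phi> t = 0" "\<And>t. 1 \<le> t \<Longrightarrow> \<phi> t = 1"
    by (rule C1_step_function) blast
  define R where "R t = P (\<phi> t)" for t
  have R: "C1_orthogonal_path R" "\<And>t. t \<le> 0 \<Longrightarrow> R t = mat 1" "\<And>t. 1 \<le> t \<Longrightarrow> R t = A"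
    using C1_orthogonal_path_compose(1)[OF P(1) \<phi>(1,2)] P \<phi>(3,4) by (simp_all add: R_def[abs_def])
  let ?R' = "\<lambda>t. vector_derivative R (at t)"
  have "compact (?R' ` {0..1})"
    by (intro compact_continuous_image continuous_on_subset[OF C1_orthogonal_pathD(4)[OF R(1)]]) auto
  then obtain B where B: "B > 0" "\<And>t. t \<in> {0..1} \<Longrightarrow> norm (?R' t) \<le> B"
    using bounded_pos[of "?R' ` {0..1}"] compact_imp_bounded by auto
  obtain K where K: "K \<ge> 0" "\<And>(M::real^'n^'n) y. norm (M *v y) \<le> norm M * norm y * K"
    using bounded_bilinear.nonneg_bounded[OF bounded_bilinear_matrix_vector_mult] by blast
  define C where "C = 2 + 2 * K * B"
  define d where "d = real CARD('n)"
  have C: "C \<ge> 2" using K(1) B(1) by (simp add: C_def)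
  have d: "d > 0" by (simp add: d_def)
  \<comment> \<open>the thickness for which \<open>C powr p * d * \<delta> powr (1 - p) \<le> \<eta>\<close>\<close>
  define \<delta> where "\<delta> = min (1 / 2) ((\<eta> / (C powr p * d)) powr (1 / (1 - p)))"
  have \<delta>: "0 < \<delta>" "\<delta> < 1" using \<open>0 < \<eta>\<close> C d by (auto simp: \<delta>_def)
  have \<delta>p: "\<delta> powr (1 - p) \<le> \<eta> / (C powr p * d)"
  proof -
    have "\<delta> powr (1 - p) \<le> ((\<eta> / (C powr p * d)) powr (1 / (1 - p))) powr (1 - p)"
      using \<delta> p by (intro powr_mono2) (auto simp: \<delta>_def)
    also have "\<dots> = \<eta> / (C powr p * d)"
      using p \<open>0 < \<eta>\<close> C d by (simp add: powr_powr)
    finally show ?thesis .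
  qed
  define \<sigma> where "\<sigma> = 1 - \<delta>"
  have \<sigma>: "0 < \<sigma>" "\<sigma> < 1" using \<delta> by (auto simp: \<sigma>_def)
  have "\<sigma>\<^sup>2 \<le> \<sigma>" using \<sigma> by (simp add: power2_eq_square mult_left_le_one_le)
  then have \<sigma>2: "\<delta> \<le> 1 - \<sigma>\<^sup>2" by (simp add: \<sigma>_def)
  define w where "w = (1 - \<sigma>\<^sup>2) * r\<^sup>2"
  have w: "0 < w" "\<delta> * r\<^sup>2 \<le> w" using \<delta> \<sigma>2 \<open>0 < r\<close> by (auto simp: w_def mult_right_mono)
  \<comment> \<open>the squared distances from \<open>(\<sigma> r)\<^sup>2\<close> to \<open>r\<^sup>2\<close> are mapped to \<open>[0, 1]\<close> with the orientation reversed\<close>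
  define Q where "Q s = R ((r\<^sup>2 - s) / w)" for s
  have lin: "((\<lambda>s. (r\<^sup>2 - s) / w) has_real_derivative - 1 / w) (at s)" for s
    using w(1) by (auto intro!: derivative_eq_intros)
  have Q_path: "C1_orthogonal_path Q"
    and Q': "vector_derivative Q (at s) = (- 1 / w) *\<^sub>R ?R' ((r\<^sup>2 - s) / w)" for s
    unfolding Q_def[abs_def]
    using C1_orthogonal_path_compose[OF R(1) lin] by auto
  have Q_out: "rotation_profile (r\<^sup>2) Q"
    using Q_path w(1) by (auto simp: rotation_profile_def Q_def intro!: R(2) divide_nonpos_pos)
  have Q_in: "Q s = A" if "s \<le> (\<sigma> * r)\<^sup>2" for s
    unfolding Q_def using that w(1)
    by (intro R(3)) (simp add: w_def power_mult_distrib algebra_simps)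
  define M where "M = C / \<delta> - 1"
  have "C \<le> C / \<delta>" using \<delta> C by (simp add: field_simps)
  then have M1: "1 \<le> M" using C by (simp add: M_def)
  have core: "twist_jacobian c Q x = A" if x: "x \<in> ball c (\<sigma> * r)" for c x
  proof -
    have "(norm (x - c))\<^sup>2 < (\<sigma> * r)\<^sup>2"
      using x by (intro power_strict_mono) (auto simp: dist_norm norm_minus_commute)
    then have s: "(x - c) \<bullet> (x - c) < (\<sigma> * r)\<^sup>2" by (simp add: power2_norm_eq_inner)
    then have "vector_derivative Q (at ((x - c) \<bullet> (x - c))) = 0"
      by (intro vector_derivative_locally_constant[of "{..<(\<sigma> * r)\<^sup>2}" _ _ A]) (auto intro: Q_in)
    then show ?thesis
      using Q_in s bounded_bilinear.zero_left[OF bounded_bilinear_outer]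
      by (simp add: twist_jacobian_def Let_def)
  qed
  have entry: "\<bar>twist_jacobian c Q x $ i $ j\<bar> \<le> M" if x: "x \<in> ball c r" for c x i j
  proof (cases "x \<in> ball c (\<sigma> * r)")
    case True
    then show ?thesis
      using core[OF True] orthogonal_matrix_entry_le_1[of A i j] A M1 by (simp add: special_orthogonal_def)
  next
    case False
    define y where "y = x - c"
    define s where "s = y \<bullet> y"
    have y: "norm y < r" "\<sigma> * r \<le> norm y" using x False by (auto simp: y_def dist_norm norm_minus_commute)
    have s: "s \<le> r\<^sup>2" "(\<sigma> * r)\<^sup>2 \<le> s"
      using y \<sigma> \<open>0 < r\<close> by (auto simp: s_def power2_norm_eq_inner[symmetric] intro!: power_mono)
    have "(r\<^sup>2 - s) / w \<in> {0..1}"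
      using s w(1) by (auto simp: w_def power_mult_distrib algebra_simps)
    then have "norm (vector_derivative Q (at s)) \<le> B / w"
      using B(2) w(1) by (simp add: Q' divide_right_mono)
    then have "norm (vector_derivative Q (at s) *v y) \<le> (B / w) * norm y * K"
      using K by (meson mult_right_mono norm_ge_zero order_trans)
    then have "norm (vector_derivative Q (at s) *v y) * norm y \<le> (B / w) * norm y * K * norm y"
      by (intro mult_right_mono) auto
    also have "\<dots> = (B / w) * K * (norm y)\<^sup>2" by (simp add: power2_eq_square)
    also have "\<dots> \<le> (B / w) * K * r\<^sup>2"
      using y(1) B(1) w(1) K(1) by (intro mult_left_mono power_mono) auto
    also have "\<dots> = (B * K) * (r\<^sup>2 / w)" by simp
    also have "\<dots> \<le> (B * K) * (1 / \<delta>)"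
      using w \<delta> B(1) K(1) by (intro mult_left_mono) (auto simp: field_simps)
    finally have 1: "norm (vector_derivative Q (at s) *v y) * norm y \<le> K * B / \<delta>"
      by (simp add: mult.commute)
    have "\<bar>(vector_derivative Q (at s) *v y) $ i * y $ j\<bar> \<le> norm (vector_derivative Q (at s) *v y) * norm y"
      unfolding abs_mult by (intro mult_mono component_le_norm_cart) auto
    then have "2 * \<bar>(vector_derivative Q (at s) *v y) $ i * y $ j\<bar> \<le> 2 * K * B / \<delta>"
      using 1 by simp
    moreover have "\<bar>Q s $ i $ j\<bar> \<le> 1"
      using orthogonal_matrix_entry_le_1 C1_orthogonal_pathD(1)[OF Q_path] by blast
    moreover have "twist_jacobian c Q x $ i $ j = Q s $ i $ j + 2 * ((vector_derivative Q (at s) *v y) $ i * y $ j)"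
      by (simp add: twist_jacobian_def Let_def s_def y_def outer_def)
    moreover have "1 + 2 * K * B / \<delta> \<le> M"
      using \<delta> by (simp add: M_def C_def field_simps)
    ultimately show ?thesis by linarith
  qed
  have "1 - \<sigma> ^ CARD('n) \<le> d * \<delta>"
    using Bernoulli_inequality[of "- \<delta>" "CARD('n)"] \<delta> by (simp add: \<sigma>_def d_def)
  then have "(M + 1) powr p * (1 - \<sigma> ^ CARD('n)) \<le> (C / \<delta>) powr p * (d * \<delta>)"
    by (simp add: M_def mult_left_mono)
  also have "\<dots> = C powr p * d * \<delta> powr (1 - p)"
    using C \<delta> by (simp add: powr_divide powr_diff)
  also have "\<dots> \<le> C powr p * d * (\<eta> / (C powr p * d))"
    using \<delta>p d by (intro mult_left_mono) auto
  also have "\<dots> = \<eta>" using C d by simp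
  finally have "(M + 1) powr p * (1 - \<sigma> ^ CARD('n)) \<le> \<eta>" .
  with Q_out \<sigma> M1 core entry show ?thesis
    by (intro exI[of _ Q] exI[of _ \<sigma>] exI[of _ M]) auto
qed

section \<open>Riemann integrable functions are nearly constant near almost every point\<close>

lemma lower_sum_eq_uminus_upper_sum: "lower_sum f \<Omega> P = - upper_sum (\<lambda>x. - f x) \<Omega> P"
  by (simp add: lower_sum_def upper_sum_def Inf_real_def image_image sum_negf[symmetric])

text \<open>
  An upper sum is the integral of the step function whose value on each cell is the supremum of \<open>f\<close>
  there. Away from the cell boundaries, a null set, this step function dominates \<open>f\<close> not only at
  the point but in a neighbourhood of it.
\<close>

lemma upper_step_function:
  fixes f :: "'a::euclidean_space \<Rightarrow> real"
  assumes f: "bounded (f ` \<Omega>)" and \<Omega>: "\<Omega> \<in> lmeasurable" and P: "P \<in> covering_divisions \<Omega>"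
  obtains u N where "integrable lebesgue u" "integral\<^sup>L lebesgue u = upper_sum f \<Omega> P"
    "negligible N" "\<And>x. x \<notin> \<Omega> \<Longrightarrow> u x = 0"
    "\<And>x. x \<in> \<Omega> - N \<Longrightarrow> \<exists>e>0. \<forall>y\<in>ball x e \<inter> \<Omega>. f y \<le> u x"
proof
  have div: "P division_of \<Union>P" and cover: "\<Omega> \<subseteq> \<Union>P"
    using P by (auto simp: covering_divisions_def)
  have fin: "finite P" using div by auto
  have box: "\<exists>a b. K = cbox a b" if "K \<in> P" for K
    using div that by (auto simp: division_of_def)
  define s where "s K = (SUP x\<in>K \<inter> \<Omega>. f x)" for K
  define u where "u x = (\<Sum>K\<in>P. s K * indicat_real (K \<inter> \<Omega>) x)" for x
  define N where "N = (\<Union>K\<in>P. frontier K)"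
  have lm: "K \<inter> \<Omega> \<in> lmeasurable" if "K \<in> P" for K
    using box[OF that] \<Omega> by auto
  have ind: "integrable lebesgue (indicat_real (K \<inter> \<Omega>))" if "K \<in> P" for K
    using lm[OF that] by (intro integrable_real_indicator)
      (auto simp: fmeasurable_def simp del: emeasure_completion)
  then show "integrable lebesgue u"
    unfolding u_def by (intro Bochner_Integration.integrable_sum integrable_mult_right)
  have "integral\<^sup>L lebesgue u = (\<Sum>K\<in>P. s K * measure lebesgue (K \<inter> \<Omega>))"
    unfolding u_def using ind by (subst Bochner_Integration.integral_sum) (auto simp: Int_commute)
  then show "integral\<^sup>L lebesgue u = upper_sum f \<Omega> P" by (simp add: upper_sum_def s_def)
  show "negligible N"
    unfolding N_def using fin box negligible_convex_frontier convex_box(1) by (intro negligible_Union) blast+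
  show "u x = 0" if "x \<notin> \<Omega>" for x using that by (simp add: u_def)
  show "\<exists>e>0. \<forall>y\<in>ball x e \<inter> \<Omega>. f y \<le> u x" if x: "x \<in> \<Omega> - N" for x
  proof -
    obtain K where K: "K \<in> P" "x \<in> K" using cover x by auto
    then have xK: "x \<in> interior K"
      using x box[OF K(1)] by (auto simp: N_def frontier_def closed_cbox closure_closed)
    have "x \<notin> L" if "L \<in> P - {K}" for L
    proof
      assume "x \<in> L"
      then have "x \<in> interior L"
        using that x box[of L] by (auto simp: N_def frontier_def closure_closed)
      moreover have "interior K \<inter> interior L = {}"
        using div that K(1) by (auto simp: division_of_def)
      ultimately show False using xK by auto
    qed
    then have "u x = (\<Sum>L\<in>P. if L = K then s K else 0)"
      unfolding u_def using K x by (intro sum.cong) auto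
    then have "u x = s K"
      using fin K by simp
    moreover obtain e where "e > 0" "ball x e \<subseteq> K"
      using xK mem_interior by blast
    moreover have "bdd_above (f ` (K \<inter> \<Omega>))"
      using f by (meson bdd_above_mono bounded_imp_bdd_above image_mono inf_le2)
    then have "f y \<le> s K" if "y \<in> K \<inter> \<Omega>" for y
      unfolding s_def using that by (intro cSUP_upper)
    ultimately show ?thesis by (intro exI[of _ e]) auto
  qed
qed

text \<open>
  The upper and the lower step function belong to different divisions, so they are compared
  pointwise, as functions: their difference bounds the oscillation of \<open>f\<close> near almost every point, and
  the Markov inequality bounds the measure of the set where the difference is at least \<open>\<epsilon>\<close>. The lower
  step function is the negative of an upper one for \<open>- f\<close>.
\<close>

lemma upper_lower_gap:
  fixes f :: "'a::euclidean_space \<Rightarrow> real"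
  assumes f: "bounded (f ` \<Omega>)" and \<Omega>: "open \<Omega>" "\<Omega> \<in> lmeasurable"
    and P: "P \<in> covering_divisions \<Omega>" and P': "P' \<in> covering_divisions \<Omega>"
  shows "0 \<le> upper_sum f \<Omega> P - lower_sum f \<Omega> P'"
    and "0 < \<epsilon> \<Longrightarrow> \<exists>T. {x \<in> \<Omega>. \<not> (\<exists>e>0. ball x e \<subseteq> \<Omega> \<and> (\<forall>y\<in>ball x e. \<bar>f y - f x\<bar> \<le> \<epsilon>))} \<subseteq> T \<and>
      T \<in> lmeasurable \<and> measure lebesgue T \<le> (upper_sum f \<Omega> P - lower_sum f \<Omega> P') / \<epsilon>"
proof -
  have f': "bounded ((\<lambda>x. - f x) ` \<Omega>)"
    using f bounded_uminus[of "f ` \<Omega>"] by (simp add: image_image)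
  obtain u N where u: "integrable lebesgue u" "integral\<^sup>L lebesgue u = upper_sum f \<Omega> P"
    "negligible N" "\<And>x. x \<notin> \<Omega> \<Longrightarrow> u x = 0"
    "\<And>x. x \<in> \<Omega> - N \<Longrightarrow> \<exists>e>0. \<forall>y\<in>ball x e \<inter> \<Omega>. f y \<le> u x"
    using upper_step_function[OF f \<Omega>(2) P] by blast
  obtain v M where v: "integrable lebesgue v" "integral\<^sup>L lebesgue v = upper_sum (\<lambda>x. - f x) \<Omega> P'"
    "negligible M" "\<And>x. x \<notin> \<Omega> \<Longrightarrow> v x = 0"
    "\<And>x. x \<in> \<Omega> - M \<Longrightarrow> \<exists>e>0. \<forall>y\<in>ball x e \<inter> \<Omega>. - f y \<le> v x"
    using upper_step_function[OF f' \<Omega>(2) P'] by blast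
  have near: "\<exists>e>0. ball x e \<subseteq> \<Omega> \<and> (\<forall>y\<in>ball x e. - v x \<le> f y \<and> f y \<le> u x)"
    if x: "x \<in> \<Omega> - (N \<union> M)" for x
  proof -
    obtain e1 where e1: "e1 > 0" "\<forall>y\<in>ball x e1 \<inter> \<Omega>. f y \<le> u x" using u(5)[of x] x by auto
    obtain e2 where e2: "e2 > 0" "\<forall>y\<in>ball x e2 \<inter> \<Omega>. - f y \<le> v x" using v(5)[of x] x by auto
    obtain e3 where e3: "e3 > 0" "ball x e3 \<subseteq> \<Omega>" using x \<Omega>(1) open_contains_ball by blast
    have "- v x \<le> f y \<and> f y \<le> u x" if "y \<in> ball x (min e1 (min e2 e3))" for y
    proof -
      have y: "y \<in> \<Omega>" "y \<in> ball x e1" "y \<in> ball x e2" using that e3 by auto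
      with e1(2) e2(2) have "f y \<le> u x" "- f y \<le> v x" by blast+
      then show ?thesis by linarith
    qed
    moreover have "ball x (min e1 (min e2 e3)) \<subseteq> \<Omega>" using e3 by auto
    ultimately show ?thesis using e1 e2 e3 by (intro exI[of _ "min e1 (min e2 e3)"]) auto
  qed
  have nonneg: "0 \<le> u x + v x" if nx: "x \<notin> N \<union> M" for x
  proof (cases "x \<in> \<Omega>")
    case True
    then obtain e where "e > 0" "\<forall>y\<in>ball x e. - v x \<le> f y \<and> f y \<le> u x"
      using near[of x] nx True by auto
    then have "- v x \<le> f x \<and> f x \<le> u x" by simp
    then show ?thesis by linarith
qed (use u(4) v(4) in auto)
  have NM: "N \<union> M \<in> null_sets lebesgue"
    using u(3) v(3) negligible_iff_null_sets by blast
  have ae: "AE x in lebesgue. 0 \<le> u x + v x"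
    by (rule AE_I'[OF NM]) (use nonneg in auto)
  have int: "integrable lebesgue (\<lambda>x. u x + v x)"
    "(\<integral>x. u x + v x \<partial>lebesgue) = upper_sum f \<Omega> P - lower_sum f \<Omega> P'"
    using u v by (auto simp: lower_sum_eq_uminus_upper_sum)
  show "0 \<le> upper_sum f \<Omega> P - lower_sum f \<Omega> P'"
    using integral_nonneg_AE[OF ae] int(2) by simp
  assume \<epsilon>: "0 < \<epsilon>"
  let ?B = "{x \<in> \<Omega>. \<not> (\<exists>e>0. ball x e \<subseteq> \<Omega> \<and> (\<forall>y\<in>ball x e. \<bar>f y - f x\<bar> \<le> \<epsilon>))}"
  let ?S = "{x. \<epsilon> \<le> u x + v x}"
  have "?B \<subseteq> ?S \<union> (N \<union> M)"
  proof
    fix x assume x: "x \<in> ?B"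
    show "x \<in> ?S \<union> (N \<union> M)"
    proof (rule ccontr)
      assume *: "x \<notin> ?S \<union> (N \<union> M)"
      then obtain e where e: "e > 0" "ball x e \<subseteq> \<Omega>" "\<forall>y\<in>ball x e. - v x \<le> f y \<and> f y \<le> u x"
        using near[of x] x by auto
      have "\<bar>f y - f x\<bar> \<le> \<epsilon>" if "y \<in> ball x e" for y
        using bspec[OF e(3) that] bspec[OF e(3), of x] e(1) * by auto
      with x e show False by blast
    qed
  qed
  moreover have S: "?S \<in> sets lebesgue"
    using measurable_sets[OF borel_measurable_integrable[OF int(1)], of "{\<epsilon>..}"]
    by (simp add: vimage_def)
  have "?S \<subseteq> \<Omega>" using \<epsilon> u(4) v(4) by force
  then have "?S \<in> lmeasurable" using S \<Omega>(2) fmeasurableI2 by blast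
  moreover have "measure lebesgue ?S \<le> (upper_sum f \<Omega> P - lower_sum f \<Omega> P') / \<epsilon>"
    using integral_Markov_inequality_measure[OF int(1) _ ae \<epsilon>, of UNIV] int(2) by simp
  moreover have "measure lebesgue (?S \<union> (N \<union> M)) = measure lebesgue ?S"
    using S NM by (rule measure_Un_null_set)
  ultimately show "\<exists>T. ?B \<subseteq> T \<and>
      T \<in> lmeasurable \<and> measure lebesgue T \<le> (upper_sum f \<Omega> P - lower_sum f \<Omega> P') / \<epsilon>"
    using NM u(3) v(3) by (intro exI[of _ "?S \<union> (N \<union> M)"])
      (auto simp: fmeasurable.Un negligible_imp_measurable)
qed

text \<open>
  The gap between an upper and a lower sum can be made arbitrarily small compared with \<open>\<epsilon>\<close>. Taken
  over all \<open>\<epsilon>\<close>, this is the continuity of \<open>f\<close> almost everywhere.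
\<close>

lemma riemann_integrable_AE_nearly_constant:
  fixes f :: "'a::euclidean_space \<Rightarrow> real"
  assumes f: "riemann_integrable_on f \<Omega>" and \<Omega>: "open \<Omega>" "bounded \<Omega>" and "0 < \<epsilon>"
  shows "negligible {x \<in> \<Omega>. \<not> (\<exists>e>0. ball x e \<subseteq> \<Omega> \<and> (\<forall>y\<in>ball x e. \<bar>f y - f x\<bar> \<le> \<epsilon>))}"
  unfolding negligible_outer_le
proof (intro allI impI)
  fix \<eta> :: real assume \<eta>: "\<eta> > 0"
  let ?D = "covering_divisions \<Omega>"
  have bf: "bounded (f ` \<Omega>)" and eq: "(SUP P\<in>?D. lower_sum f \<Omega> P) = (INF P\<in>?D. upper_sum f \<Omega> P)"
    using f by (auto simp: riemann_integrable_on_def)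
  have lm: "\<Omega> \<in> lmeasurable" using \<Omega> by (rule lmeasurable_open[rotated])
  note gap = upper_lower_gap[OF bf \<Omega>(1) lm]
  obtain a where a: "\<Omega> \<subseteq> cbox (-a) a" using bounded_subset_cbox_symmetric \<Omega>(2) by blast
  have ne: "?D \<noteq> {}"
  proof (cases "cbox (-a) a = {}")
    case True
    then have "{} \<in> ?D" using a by (auto simp: covering_divisions_def)
    then show ?thesis by blast
  next
    case False
    then have "{cbox (-a) a} \<in> ?D" using a by (auto simp: covering_divisions_def)
    then show ?thesis by blast
  qed
  then obtain P0 where P0: "P0 \<in> ?D" by blast
  have "bdd_above (lower_sum f \<Omega> ` ?D)"
    using gap(1)[OF P0] by (intro bdd_aboveI[of _ "upper_sum f \<Omega> P0"]) auto
  then obtain P' where P': "P' \<in> ?D" "(SUP P\<in>?D. lower_sum f \<Omega> P) - \<eta> * \<epsilon> / 2 < lower_sum f \<Omega> P'"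
    using less_cSUP_iff[OF ne, of "lower_sum f \<Omega>" "(SUP P\<in>?D. lower_sum f \<Omega> P) - \<eta> * \<epsilon> / 2"]
      \<eta> \<open>0 < \<epsilon>\<close> by auto
  have "bdd_below (upper_sum f \<Omega> ` ?D)"
    using gap(1)[OF _ P0] by (intro bdd_belowI[of _ "lower_sum f \<Omega> P0"]) auto
  then obtain P where P: "P \<in> ?D" "upper_sum f \<Omega> P < (INF P\<in>?D. upper_sum f \<Omega> P) + \<eta> * \<epsilon> / 2"
    using cINF_less_iff[OF ne, of "upper_sum f \<Omega>" "(INF P\<in>?D. upper_sum f \<Omega> P) + \<eta> * \<epsilon> / 2"]
      \<eta> \<open>0 < \<epsilon>\<close> by auto
  have "upper_sum f \<Omega> P - lower_sum f \<Omega> P' \<le> \<eta> * \<epsilon>"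
    using P(2) P'(2) eq by (simp add: field_simps)
  then have "(upper_sum f \<Omega> P - lower_sum f \<Omega> P') / \<epsilon> \<le> \<eta>"
    using \<open>0 < \<epsilon>\<close> by (simp add: field_simps)
  then show "\<exists>T. {x \<in> \<Omega>. \<not> (\<exists>e>0. ball x e \<subseteq> \<Omega> \<and> (\<forall>y\<in>ball x e. \<bar>f y - f x\<bar> \<le> \<epsilon>))} \<subseteq> T
      \<and> T \<in> lmeasurable \<and> measure lebesgue T \<le> \<eta>"
    using gap(2)[OF P(1) P'(1) \<open>0 < \<epsilon>\<close>] order_trans by blast
qed

text \<open>
  Removing the null sets for all oscillation bounds \<open>1 / (n + 1)\<close> leaves a set on which \<open>f\<close> is
  continuous.
\<close>

lemma riemann_integrable_measurable:
  fixes f :: "'a::euclidean_space \<Rightarrow> real"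
  assumes f: "riemann_integrable_on f \<Omega>" and \<Omega>: "open \<Omega>" "bounded \<Omega>"
  shows "f \<in> borel_measurable (lebesgue_on \<Omega>)"
proof -
  define B where "B \<epsilon> = {x \<in> \<Omega>. \<not> (\<exists>e>0. ball x e \<subseteq> \<Omega> \<and> (\<forall>y\<in>ball x e. \<bar>f y - f x\<bar> \<le> \<epsilon>))}" for \<epsilon>
  define N where "N = (\<Union>n. B (inverse (real (Suc n))))"
  have N: "negligible N"
    unfolding N_def B_def
    by (intro negligible_Union_nat riemann_integrable_AE_nearly_constant[OF f \<Omega>]) auto
  have leb: "\<Omega> \<in> sets lebesgue" "\<Omega> - N \<in> sets lebesgue"
    using \<Omega>(1) negligible_imp_sets[OF N] by (auto intro: sets.Diff)
  have "continuous_on (\<Omega> - N) f"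
    unfolding continuous_on_iff
  proof (intro ballI allI impI)
    fix x and \<epsilon> :: real assume x: "x \<in> \<Omega> - N" and "0 < \<epsilon>"
    then obtain n where n: "inverse (real (Suc n)) < \<epsilon>" using reals_Archimedean by blast
    from x have "x \<notin> B (inverse (real (Suc n)))" by (auto simp: N_def)
    with x obtain e where e: "e > 0" "\<forall>y\<in>ball x e. \<bar>f y - f x\<bar> \<le> inverse (real (Suc n))"
      unfolding B_def by blast
    have "dist (f y) (f x) < \<epsilon>" if "dist y x < e" for y
    proof -
      have "\<bar>f y - f x\<bar> \<le> inverse (real (Suc n))" using e(2) that by (simp add: dist_commute)
      with n show ?thesis by (simp only: dist_real_def)
    qed
    with e(1) show "\<exists>d>0. \<forall>y\<in>\<Omega> - N. dist y x < d \<longrightarrow> dist (f y) (f x) < \<epsilon>" by blast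
  qed
  then have "f \<in> borel_measurable (lebesgue_on (\<Omega> - N))"
    using leb(2) by (rule continuous_imp_measurable_on_sets_lebesgue)
  then have "(\<lambda>x. if x \<in> \<Omega> - N then f x else 0) \<in> borel_measurable lebesgue"
    using borel_measurable_if leb(2) by blast
  moreover have "AE x in lebesgue. (if x \<in> \<Omega> - N then f x else 0) = (if x \<in> \<Omega> then f x else 0)"
    by (rule AE_I'[of N]) (use N in \<open>auto simp: negligible_iff_null_sets\<close>)
  ultimately have "(\<lambda>x. if x \<in> \<Omega> then f x else 0) \<in> borel_measurable lebesgue"
    by (rule borel_measurable_AE)
  then show ?thesis using borel_measurable_if leb(1) by blast
qed

section \<open>Approximation of the identity with prescribed derivative\<close>

lemma bounded_measurable_in_Lp_functions:
  assumes "\<Omega> \<in> lmeasurable" "g \<in> borel_measurable (lebesgue_on \<Omega>)" "0 \<le> p"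
    and "\<And>x. x \<in> \<Omega> \<Longrightarrow> \<bar>g x\<bar> \<le> B"
  shows "g \<in> Lp_functions p \<Omega>"
proof -
  interpret finite_measure "lebesgue_on \<Omega>" using assms(1) by (rule finite_measure_lebesgue_on)
  have "integrable (lebesgue_on \<Omega>) (\<lambda>x. \<bar>g x\<bar> powr p)"
  proof (rule integrable_const_bound)
    show "AE x in lebesgue_on \<Omega>. norm (\<bar>g x\<bar> powr p) \<le> B powr p"
      using assms(3,4) by (intro AE_I2) (auto intro: powr_mono2)
  qed (use assms(2) in measurable)
  with assms(2) show ?thesis by (simp add: Lp_functions_def)
qed

lemma matrix_riemann_integrable_AE_nearly_constant:
  fixes H :: "real^'n \<Rightarrow> real^'n^'n"
  assumes H: "matrix_riemann_integrable_on H \<Omega>" and \<Omega>: "open \<Omega>" "bounded \<Omega>" and \<epsilon>: "0 < \<epsilon>"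
  shows "negligible {x \<in> \<Omega>. \<not> (\<exists>e>0. ball x e \<subseteq> \<Omega> \<and> (\<forall>y\<in>ball x e. \<forall>i j. \<bar>H y $ i $ j - H x $ i $ j\<bar> \<le> \<epsilon>))}"
    (is "negligible ?B")
proof -
  define N where "N = (\<lambda>(i, j). {x \<in> \<Omega>. \<not> (\<exists>e>0. ball x e \<subseteq> \<Omega> \<and>
    (\<forall>y\<in>ball x e. \<bar>H y $ i $ j - H x $ i $ j\<bar> \<le> \<epsilon>))})"
  have "negligible (N ij)" for ij
    using riemann_integrable_AE_nearly_constant[OF _ \<Omega> \<epsilon>] H
    by (cases ij) (simp add: N_def matrix_riemann_integrable_on_def)
  then have "negligible (\<Union>ij. N ij)" by (intro negligible_Union) auto
  moreover have "?B \<subseteq> (\<Union>ij. N ij)"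
  proof
    fix x assume x: "x \<in> ?B"
    show "x \<in> (\<Union>ij. N ij)"
    proof (rule ccontr)
      assume "x \<notin> (\<Union>ij. N ij)"
      then have "\<exists>e>0. ball x e \<subseteq> \<Omega> \<and> (\<forall>y\<in>ball x e. \<bar>H y $ fst ij $ snd ij - H x $ fst ij $ snd ij\<bar> \<le> \<epsilon>)" for ij
      proof (cases ij)
        case (Pair i j)
        have "x \<notin> N (i, j)" using \<open>x \<notin> (\<Union>ij. N ij)\<close> by blast
        with x show ?thesis unfolding N_def Pair by simp blast
      qed
      then obtain e where e: "\<And>ij. 0 < e ij" "\<And>ij. ball x (e ij) \<subseteq> \<Omega>"
          "\<And>ij y. y \<in> ball x (e ij) \<Longrightarrow> \<bar>H y $ fst ij $ snd ij - H x $ fst ij $ snd ij\<bar> \<le> \<epsilon>"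
        by metis
      \<comment> \<open>one radius for all of the finitely many entries\<close>
      define d where "d = Min (range e)"
      have d: "d > 0" "\<And>ij. d \<le> e ij" using e(1) by (auto simp: d_def)
      have sub: "ball x d \<subseteq> ball x (e ij)" for ij using d(2) by (rule subset_ball)
      have "ball x d \<subseteq> \<Omega>" using sub e(2) by blast
      moreover have "\<bar>H y $ i $ j - H x $ i $ j\<bar> \<le> \<epsilon>" if "y \<in> ball x d" for y i j
        using e(3)[of y "(i, j)"] subsetD[OF sub that, of "(i, j)"] by simp
      ultimately show False using x d(1) by blast
    qed
  qed
  ultimately show ?thesis by (rule negligible_subset)
qed

text \<open>
  The balls on which the local condition holds form a Vitali cover of almost all of \<open>\<Omega>\<close>. A countable
  disjoint subfamily exhausts \<open>\<Omega>\<close> up to a null set, so finitely many of its balls leave little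
  measure uncovered.
\<close>

lemma finite_ball_packing:
  fixes \<Omega> :: "'a::euclidean_space set"
  assumes \<Omega>: "open \<Omega>" "bounded \<Omega>" and "0 < \<epsilon>"
    and local: "negligible {x \<in> \<Omega>. \<not> (\<exists>e>0. ball x e \<subseteq> \<Omega> \<and> (\<forall>y\<in>ball x e. R x y))}"
  obtains F where "finite F"
    "\<And>x r. (x, r) \<in> F \<Longrightarrow> x \<in> \<Omega> \<and> 0 < r \<and> r \<le> \<epsilon> \<and> ball x r \<subseteq> \<Omega> \<and> (\<forall>y\<in>ball x r. R x y)"
    "pairwise (\<lambda>i j. disjnt (ball (fst i) (snd i)) (ball (fst j) (snd j))) F"
    "measure lebesgue (\<Omega> - (\<Union>i\<in>F. ball (fst i) (snd i))) \<le> \<epsilon>"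
proof -
  define G where "G = {x \<in> \<Omega>. \<exists>e>0. ball x e \<subseteq> \<Omega> \<and> (\<forall>y\<in>ball x e. R x y)}"
  define K where "K = {(x, r). x \<in> G \<and> 0 < r \<and> r \<le> \<epsilon> \<and> ball x r \<subseteq> \<Omega> \<and> (\<forall>y\<in>ball x r. R x y)}"
  let ?b = "\<lambda>i. ball (fst i) (snd i)"
  have "\<exists>i. i \<in> K \<and> x \<in> ?b i \<and> snd i < d" if x: "x \<in> G" and d: "0 < d" for x d
  proof -
    obtain e where e: "e > 0" "ball x e \<subseteq> \<Omega>" "\<forall>y\<in>ball x e. R x y" using x by (auto simp: G_def)
    define r where "r = min (d / 2) (min e \<epsilon>)"
    have "ball x r \<subseteq> ball x e" by (rule subset_ball) (simp add: r_def)
    then have "(x, r) \<in> K" using x e d \<open>0 < \<epsilon>\<close> by (auto simp: K_def r_def)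
    then show ?thesis using d e \<open>0 < \<epsilon>\<close> by (intro exI[of _ "(x, r)"]) (auto simp: r_def)
  qed
  then obtain C where C: "countable C" "C \<subseteq> K" "pairwise (\<lambda>i j. disjnt (?b i) (?b j)) C"
      "negligible (G - (\<Union>i\<in>C. ?b i))"
    by (rule Vitali_covering_theorem_balls[of G K fst snd])
  have lm: "\<Omega> \<in> lmeasurable" using \<Omega> by (simp add: lmeasurable_open)
  have sub: "?b i \<subseteq> \<Omega>" if "i \<in> C" for i
    using subsetD[OF C(2) that] by (cases i) (simp add: K_def)
  obtain D where D: "D \<subseteq> ?b ` C" "finite D" "measure lebesgue (\<Union>(?b ` C)) - \<epsilon> < measure lebesgue (\<Union>D)"
  proof (rule measure_countable_Union_approachable[of "?b ` C" \<epsilon> "measure lebesgue \<Omega>"])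
    show "measure lebesgue (\<Union>D) \<le> measure lebesgue \<Omega>" if "D \<subseteq> ?b ` C" "finite D" for D
    proof (rule measure_mono_fmeasurable[OF _ _ lm])
      show "\<Union>D \<subseteq> \<Omega>" using that(1) sub by blast
      show "\<Union>D \<in> sets lebesgue" using that by (intro sets.finite_Union) auto
    qed
  qed (use C(1) \<open>0 < \<epsilon>\<close> in auto)
  obtain F where F: "F \<subseteq> C" "finite F" "D = ?b ` F"
    using finite_subset_image[OF D(2,1)] by (elim exE conjE)
  have UF: "(\<Union>i\<in>F. ?b i) \<in> lmeasurable" "(\<Union>i\<in>F. ?b i) \<subseteq> \<Omega>"
    using F sub by (auto intro!: fmeasurable.finite_UN)
  have UC: "(\<Union>i\<in>C. ?b i) \<in> sets lebesgue" using C(1) by (intro sets.countable_UN') auto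
  have "\<Omega> - (\<Union>i\<in>C. ?b i) \<subseteq> {x \<in> \<Omega>. \<not> (\<exists>e>0. ball x e \<subseteq> \<Omega> \<and> (\<forall>y\<in>ball x e. R x y))} \<union> (G - (\<Union>i\<in>C. ?b i))"
    by (auto simp: G_def)
  then have "negligible (\<Omega> - (\<Union>i\<in>C. ?b i))"
    using local C(4) negligible_Un negligible_subset by blast
  moreover have "(\<Union>i\<in>C. ?b i) \<subseteq> \<Omega>" using sub by blast
  ultimately have "measure lebesgue \<Omega> = measure lebesgue (\<Union>i\<in>C. ?b i)"
    using lm by (intro measure_negligible_symdiff[symmetric]) (simp_all add: Diff_eq_empty_iff[THEN iffD2])
  moreover have "measure lebesgue (\<Omega> - (\<Union>i\<in>F. ?b i)) = measure lebesgue \<Omega> - measure lebesgue (\<Union>i\<in>F. ?b i)"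
    using UF lm by (intro measurable_measure_Diff) auto
  ultimately have "measure lebesgue (\<Omega> - (\<Union>i\<in>F. ?b i)) \<le> \<epsilon>"
    using D(3) F(3) by simp
  then show thesis
    using F C(2) pairwise_subset[OF C(3) F(1)] by (intro that[of F]) (auto simp: K_def G_def)
qed

lemma measure_shell:
  fixes x :: "real^'n"
  assumes "0 < \<sigma>" "\<sigma> < 1" "0 < r"
  shows "measure lebesgue (ball x r - ball x (\<sigma> * r)) = (1 - \<sigma> ^ CARD('n)) * measure lebesgue (ball x r)"
proof -
  have "ball x (\<sigma> * r) \<subseteq> ball x r"
    using assms by (intro subset_ball) (simp add: mult_left_le_one_le)
  then have "measure lebesgue (ball x r - ball x (\<sigma> * r)) = measure lebesgue (ball x r) - measure lebesgue (ball x (\<sigma> * r))"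
    by (intro measurable_measure_Diff) auto
  also have "\<dots> = (1 - \<sigma> ^ CARD('n)) * measure lebesgue (ball x r)"
    using assms by (simp add: content_ball power_mult_distrib algebra_simps)
  finally show ?thesis .
qed

text \<open>
  On each ball of a packing the twist with core matrix \<open>A = H c\<close>, with \<open>c\<close> the centre, is applied. The
  three terms of the bound come from the uncovered part of \<open>\<Omega>\<close> (where the entries of the difference
  are at most \<open>2\<close>), from the cores (where \<open>H\<close> differs from \<open>A\<close> by at most \<open>\<epsilon>\<close>), and from the shells.
\<close>

lemma admissible_map_near_id_jacobian_near:
  fixes H :: "real^'n \<Rightarrow> real^'n^'n"
  assumes p: "0 < p" "p < 1" and \<Omega>: "bounded \<Omega>" "open \<Omega>"
    and SO: "\<forall>x\<in>\<Omega>. H x \<in> special_orthogonal" and H: "matrix_riemann_integrable_on H \<Omega>"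
    and \<epsilon>: "0 < \<epsilon>"
  shows "\<exists>f. f \<in> admissible_maps \<Omega> \<and> (\<forall>x\<in>\<Omega>. norm (f x - x) \<le> 2 * \<epsilon>) \<and>
    (\<lambda>x. jacobian f (at x)) \<in> Lp_matrix_functions p \<Omega> \<and>
    (\<forall>i j. (\<integral>x. \<bar>jacobian f (at x) $ i $ j - H x $ i $ j\<bar> powr p \<partial>lebesgue_on \<Omega>)
      \<le> 2 powr p * \<epsilon> + (\<epsilon> powr p + \<epsilon>) * measure lebesgue \<Omega>)"
proof -
  have lm: "\<Omega> \<in> lmeasurable" using \<Omega> by (simp add: lmeasurable_open)
  interpret fin: finite_measure "lebesgue_on \<Omega>" using lm by (rule finite_measure_lebesgue_on)
  let ?b = "\<lambda>i :: (real^'n) \<times> real. ball (fst i) (snd i)"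
  obtain F where F: "finite F"
    "\<And>x r. (x, r) \<in> F \<Longrightarrow> x \<in> \<Omega> \<and> 0 < r \<and> r \<le> \<epsilon> \<and> ball x r \<subseteq> \<Omega> \<and>
      (\<forall>y\<in>ball x r. \<forall>i j. \<bar>H y $ i $ j - H x $ i $ j\<bar> \<le> \<epsilon>)"
    "pairwise (\<lambda>i j. disjnt (?b i) (?b j)) F" "measure lebesgue (\<Omega> - (\<Union>i\<in>F. ?b i)) \<le> \<epsilon>"
    using finite_ball_packing[OF \<Omega>(2,1) \<epsilon> matrix_riemann_integrable_AE_nearly_constant[OF H \<Omega>(2,1) \<epsilon>]]
    by blast
  have Fi: "fst k \<in> \<Omega>" "0 < snd k" "snd k \<le> \<epsilon>" "?b k \<subseteq> \<Omega>"
      "\<And>y i j. y \<in> ?b k \<Longrightarrow> \<bar>H y $ i $ j - H (fst k) $ i $ j\<bar> \<le> \<epsilon>" if "k \<in> F" for k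
    using F(2)[of "fst k" "snd k"] that by auto
  have "\<forall>k\<in>F. \<exists>Q \<sigma> M. rotation_profile ((snd k)\<^sup>2) Q \<and> 0 < \<sigma> \<and> \<sigma> < 1 \<and> 0 \<le> M \<and>
    (\<forall>c. \<forall>x\<in>ball c (\<sigma> * snd k). twist_jacobian c Q x = H (fst k)) \<and>
    (\<forall>c. \<forall>x\<in>ball c (snd k). \<forall>i j. \<bar>twist_jacobian c Q x $ i $ j\<bar> \<le> M) \<and>
    (M + 1) powr p * (1 - \<sigma> ^ CARD('n)) \<le> \<epsilon>"
    using thin_shell_profile[OF _ p _ \<epsilon>] Fi SO by blast
  then obtain Q \<sigma> M where Q: "\<And>k. k \<in> F \<Longrightarrow> rotation_profile ((snd k)\<^sup>2) (Q k) \<and> 0 < \<sigma> k \<and> \<sigma> k < 1 \<and> 0 \<le> M k \<and>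
    (\<forall>c. \<forall>x\<in>ball c (\<sigma> k * snd k). twist_jacobian c (Q k) x = H (fst k)) \<and>
    (\<forall>c. \<forall>x\<in>ball c (snd k). \<forall>i j. \<bar>twist_jacobian c (Q k) x $ i $ j\<bar> \<le> M k) \<and>
    (M k + 1) powr p * (1 - \<sigma> k ^ CARD('n)) \<le> \<epsilon>"
    by metis
  interpret disjoint_twists F fst snd Q
    using F(1,3) Fi(2) Q by unfold_locales auto
  define shell where "shell k = ?b k - ball (fst k) (\<sigma> k * snd k)" for k
  let ?V = "\<Omega> - (\<Union>i\<in>F. ?b i)"
  have Hbd: "\<bar>H x $ i $ j\<bar> \<le> 1" if "x \<in> \<Omega>" for x i j
    using SO that orthogonal_matrix_entry_le_1[of "H x" i j] by (auto simp: special_orthogonal_def)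
  have shell_sets: "shell k \<in> sets lebesgue" "shell k \<subseteq> \<Omega>" if "k \<in> F" for k
    using Fi(4)[OF that] by (auto simp: shell_def)
  have V_sets: "?V \<in> sets lebesgue" using F(1) lm by (intro sets.Diff sets.finite_UN) auto
  \<comment> \<open>pointwise bound for the \<open>p\<close>-th power of every entry of the difference, collecting the three regions\<close>
  define g where "g x = 2 powr p * indicat_real ?V x + \<epsilon> powr p
    + (\<Sum>k\<in>F. (M k + 1) powr p * indicat_real (shell k) x)" for x
  have bound: "\<bar>glued_jacobian x $ i $ j - H x $ i $ j\<bar> powr p \<le> g x" if x: "x \<in> \<Omega>" for x i j
  proof -
    have sum0: "0 \<le> (\<Sum>k\<in>F. (M k + 1) powr p * indicat_real (shell k) x)" by (intro sum_nonneg) auto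
    consider "x \<in> ?V" | k where "k \<in> F" "x \<in> ball (fst k) (\<sigma> k * snd k)" "x \<in> ?b k"
      | k where "k \<in> F" "x \<in> shell k" "x \<in> ?b k"
    proof (cases "x \<in> ?V")
      case False
      then obtain k where k: "k \<in> F" "x \<in> ?b k" using x by blast
      then show thesis
        using that(2)[OF k(1) _ k(2)] that(3)[OF k(1) _ k(2)] unfolding shell_def by blast
    qed (rule that(1))
    then show ?thesis
    proof cases
      case 1
      then have "glued_jacobian x = mat 1" by (intro glued_outside) auto
      then have "\<bar>glued_jacobian x $ i $ j - H x $ i $ j\<bar> \<le> 2"
        using Hbd[OF x, of i j] by (auto simp: mat_def)
      then have "\<bar>glued_jacobian x $ i $ j - H x $ i $ j\<bar> powr p \<le> 2 powr p"
        using p by (intro powr_mono2) auto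
      with 1 sum0 show ?thesis unfolding g_def by (simp add: add_increasing2)
    next
      case 2
      then have "glued_jacobian x = H (fst k)" using glued_in_ball(2) Q by metis
      then have "\<bar>glued_jacobian x $ i $ j - H x $ i $ j\<bar> \<le> \<epsilon>"
        using Fi(5)[OF 2(1,3), of i j] by (simp add: abs_minus_commute)
      then have "\<bar>glued_jacobian x $ i $ j - H x $ i $ j\<bar> powr p \<le> \<epsilon> powr p"
        using p by (intro powr_mono2) auto
      with sum0 show ?thesis unfolding g_def by (simp add: add_increasing add_increasing2)
    next
      case 3
      then have "\<bar>glued_jacobian x $ i $ j\<bar> \<le> M k" using glued_in_ball(2) Q by metis
      then have "\<bar>glued_jacobian x $ i $ j - H x $ i $ j\<bar> \<le> M k + 1"
        using Hbd[OF x, of i j] by linarith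
      then have "\<bar>glued_jacobian x $ i $ j - H x $ i $ j\<bar> powr p \<le> (M k + 1) powr p"
        using p by (intro powr_mono2) auto
      also have "\<dots> = (M k + 1) powr p * indicat_real (shell k) x" using 3 by simp
      also have "\<dots> \<le> (\<Sum>k\<in>F. (M k + 1) powr p * indicat_real (shell k) x)"
        using 3(1) F(1) by (intro member_le_sum) auto
      finally show ?thesis unfolding g_def by (simp add: add_increasing)
    qed
  qed
  have ind: "integrable (lebesgue_on \<Omega>) (indicat_real A)" "(\<integral>x. indicat_real A x \<partial>lebesgue_on \<Omega>) = measure lebesgue A"
    if "A \<in> sets lebesgue" "A \<subseteq> \<Omega>" for A
  proof -
    have "A \<in> sets (lebesgue_on \<Omega>)" using that lm by (auto simp: sets_restrict_space_iff)
    then show "integrable (lebesgue_on \<Omega>) (indicat_real A)"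
      by (intro integrable_real_indicator) (auto simp: fin.emeasure_eq_measure)
    show "(\<integral>x. indicat_real A x \<partial>lebesgue_on \<Omega>) = measure lebesgue A"
      using that lm by (simp add: measure_restrict_space Int_absorb2 fmeasurableD)
  qed
  have V_int: "integrable (lebesgue_on \<Omega>) (\<lambda>x. 2 powr p * indicat_real ?V x)"
    using V_sets by (intro integrable_mult_right ind) auto
  have shell_int: "integrable (lebesgue_on \<Omega>) (\<lambda>x. (M k + 1) powr p * indicat_real (shell k) x)"
    if "k \<in> F" for k
    using shell_sets[OF that] by (intro integrable_mult_right ind)
  have g_int: "integrable (lebesgue_on \<Omega>) g"
    unfolding g_def by (intro Bochner_Integration.integrable_add Bochner_Integration.integrable_sum
        V_int shell_int fin.integrable_const)
  have "(\<integral>x. g x \<partial>lebesgue_on \<Omega>) = (\<integral>x. 2 powr p * indicat_real ?V x \<partial>lebesgue_on \<Omega>)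
      + (\<integral>x. \<epsilon> powr p \<partial>lebesgue_on \<Omega>)
      + (\<Sum>k\<in>F. \<integral>x. (M k + 1) powr p * indicat_real (shell k) x \<partial>lebesgue_on \<Omega>)"
    unfolding g_def
    by (simp only: Bochner_Integration.integral_add Bochner_Integration.integral_sum
        Bochner_Integration.integrable_add Bochner_Integration.integrable_sum
        V_int shell_int fin.integrable_const)
  also have "\<dots> = 2 powr p * measure lebesgue ?V + \<epsilon> powr p * measure lebesgue \<Omega>
      + (\<Sum>k\<in>F. (M k + 1) powr p * measure lebesgue (shell k))"
  proof -
    have a: "(\<integral>x. 2 powr p * indicat_real ?V x \<partial>lebesgue_on \<Omega>) = 2 powr p * measure lebesgue ?V"
      by (subst integral_mult_right_zero, subst ind) (use V_sets in auto)
    have b: "(\<integral>x. (M k + 1) powr p * indicat_real (shell k) x \<partial>lebesgue_on \<Omega>)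
        = (M k + 1) powr p * measure lebesgue (shell k)" if "k \<in> F" for k
      by (subst integral_mult_right_zero, subst ind) (use shell_sets[OF that] in auto)
    have c: "(\<integral>x. \<epsilon> powr p \<partial>lebesgue_on \<Omega>) = \<epsilon> powr p * measure lebesgue \<Omega>"
      using lm by (simp add: measure_restrict_space fmeasurableD)
    have "(\<Sum>k\<in>F. \<integral>x. (M k + 1) powr p * indicat_real (shell k) x \<partial>lebesgue_on \<Omega>)
        = (\<Sum>k\<in>F. (M k + 1) powr p * measure lebesgue (shell k))"
      by (rule sum.cong[OF refl b])
    with a c show ?thesis by (simp only:)
  qed
  also have "(\<Sum>k\<in>F. (M k + 1) powr p * measure lebesgue (shell k)) \<le> (\<Sum>k\<in>F. \<epsilon> * measure lebesgue (?b k))"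
  proof (rule sum_mono)
    fix k assume k: "k \<in> F"
    have "(M k + 1) powr p * measure lebesgue (shell k)
        = ((M k + 1) powr p * (1 - \<sigma> k ^ CARD('n))) * measure lebesgue (?b k)"
      using measure_shell[of "\<sigma> k" "snd k" "fst k"] Q[OF k] Fi(2)[OF k] by (simp add: shell_def)
    also have "\<dots> \<le> \<epsilon> * measure lebesgue (?b k)"
      using Q[OF k] by (intro mult_right_mono) auto
    finally show "(M k + 1) powr p * measure lebesgue (shell k) \<le> \<epsilon> * measure lebesgue (?b k)" .
  qed
  also have "(\<Sum>k\<in>F. \<epsilon> * measure lebesgue (?b k)) = \<epsilon> * measure lebesgue (\<Union>k\<in>F. ?b k)"
    using F(1,3) by (subst measure_UNION') (auto simp: sum_distrib_left)
  also have "\<epsilon> * measure lebesgue (\<Union>k\<in>F. ?b k) \<le> \<epsilon> * measure lebesgue \<Omega>"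
    using \<epsilon> Fi(4) F(1) lm by (intro mult_left_mono measure_mono_fmeasurable) (auto intro!: sets.finite_UN)
  also have "2 powr p * measure lebesgue ?V \<le> 2 powr p * \<epsilon>" using F(4) by simp
  finally have g_le: "(\<integral>x. g x \<partial>lebesgue_on \<Omega>) \<le> 2 powr p * \<epsilon> + (\<epsilon> powr p + \<epsilon>) * measure lebesgue \<Omega>"
    by (simp add: algebra_simps)
  have J_cont: "continuous_on S (\<lambda>x. glued_jacobian x $ i $ j)" for i j S
    by (intro continuous_intros continuous_on_subset[OF continuous_on_glued_jacobian]) auto
  have J_meas: "(\<lambda>x. glued_jacobian x $ i $ j) \<in> borel_measurable (lebesgue_on \<Omega>)" for i j
    using J_cont lm by (intro continuous_imp_measurable_on_sets_lebesgue) auto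
  have H_meas: "(\<lambda>x. H x $ i $ j) \<in> borel_measurable (lebesgue_on \<Omega>)" for i j
    using H \<Omega> by (intro riemann_integrable_measurable) (auto simp: matrix_riemann_integrable_on_def)
  have "(\<integral>x. \<bar>glued_jacobian x $ i $ j - H x $ i $ j\<bar> powr p \<partial>lebesgue_on \<Omega>)
      \<le> (\<integral>x. g x \<partial>lebesgue_on \<Omega>)" for i j
  proof (rule integral_mono[OF _ g_int])
    show "integrable (lebesgue_on \<Omega>) (\<lambda>x. \<bar>glued_jacobian x $ i $ j - H x $ i $ j\<bar> powr p)"
    proof (rule Bochner_Integration.integrable_bound[OF g_int])
      show "(\<lambda>x. \<bar>glued_jacobian x $ i $ j - H x $ i $ j\<bar> powr p) \<in> borel_measurable (lebesgue_on \<Omega>)"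
        using J_meas[of i j] H_meas[of i j] by measurable
      show "AE x in lebesgue_on \<Omega>. norm (\<bar>glued_jacobian x $ i $ j - H x $ i $ j\<bar> powr p) \<le> norm (g x)"
        using bound[THEN order_trans, OF _ abs_ge_self] by (intro AE_I2) auto
    qed
  qed (use bound in auto)
  note this[THEN order_trans, OF g_le]
  moreover have "(\<lambda>x. glued_jacobian x $ i $ j) \<in> Lp_functions p \<Omega>" for i j
  proof -
    have "bounded ((\<lambda>x. glued_jacobian x $ i $ j) ` closure \<Omega>)"
      using \<Omega>(1) J_cont by (intro compact_imp_bounded compact_continuous_image) auto
    then obtain B where "\<forall>x\<in>closure \<Omega>. \<bar>glued_jacobian x $ i $ j\<bar> \<le> B"
      by (auto simp: bounded_iff)
    then show ?thesis
      using p closure_subset by (intro bounded_measurable_in_Lp_functions[OF lm J_meas, of _ _ _ B]) auto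
  qed
  moreover have "norm (glued x - x) \<le> 2 * \<epsilon>" for x
    using Fi(3) \<epsilon> by (intro norm_glued_diff) auto
  moreover have "glued \<in> admissible_maps \<Omega>"
    using \<Omega> Fi(4) by (rule glued_admissible)
  ultimately show ?thesis
    by (intro exI[of _ glued]) (auto simp: jacobian_glued Lp_matrix_functions_def)
qed

theorem theorem2:
  fixes p :: real and \<Omega> :: "(real^'n) set" and H :: "real^'n \<Rightarrow> real^'n^'n"
  assumes "CARD('n) \<ge> 2"
    and "0 < p" and "p < 1"
    and "bounded \<Omega>" and "open \<Omega>"
    and "\<forall>x\<in>\<Omega>. H x \<in> special_orthogonal"
    and "matrix_riemann_integrable_on H \<Omega>"
  shows "(id, H) \<in> M1p p \<Omega>"
proof -
  note p = assms(2,3) and \<Omega> = assms(4,5) and SO = assms(6) and H = assms(7)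
  have lm: "\<Omega> \<in> lmeasurable" using \<Omega> by (simp add: lmeasurable_open)
  define \<epsilon> where "\<epsilon> n = inverse (real (Suc n))" for n
  have \<epsilon>: "0 < \<epsilon> n" for n by (simp add: \<epsilon>_def)
  have \<epsilon>0: "\<epsilon> \<longlonglongrightarrow> 0" unfolding \<epsilon>_def[abs_def] by (rule LIMSEQ_inverse_real_of_nat)
  define \<beta> where "\<beta> n = 2 powr p * \<epsilon> n + (\<epsilon> n powr p + \<epsilon> n) * measure lebesgue \<Omega>" for n
  have "\<forall>n. \<exists>f. f \<in> admissible_maps \<Omega> \<and> (\<forall>x\<in>\<Omega>. norm (f x - x) \<le> 2 * \<epsilon> n) \<and>
      (\<lambda>x. jacobian f (at x)) \<in> Lp_matrix_functions p \<Omega> \<and>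
      (\<forall>i j. (\<integral>x. \<bar>jacobian f (at x) $ i $ j - H x $ i $ j\<bar> powr p \<partial>lebesgue_on \<Omega>) \<le> \<beta> n)"
    unfolding \<beta>_def by (intro allI admissible_map_near_id_jacobian_near[OF p \<Omega> SO H \<epsilon>])
  then obtain fs where fs': "\<forall>n. fs n \<in> admissible_maps \<Omega> \<and> (\<forall>x\<in>\<Omega>. norm (fs n x - x) \<le> 2 * \<epsilon> n) \<and>
      (\<lambda>x. jacobian (fs n) (at x)) \<in> Lp_matrix_functions p \<Omega> \<and>
      (\<forall>i j. (\<integral>x. \<bar>jacobian (fs n) (at x) $ i $ j - H x $ i $ j\<bar> powr p \<partial>lebesgue_on \<Omega>) \<le> \<beta> n)"
    by (rule choice[THEN exE])
  have fs: "fs n \<in> admissible_maps \<Omega>" "x \<in> \<Omega> \<Longrightarrow> norm (fs n x - x) \<le> 2 * \<epsilon> n"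
    "(\<lambda>x. jacobian (fs n) (at x)) \<in> Lp_matrix_functions p \<Omega>"
    "(\<integral>x. \<bar>jacobian (fs n) (at x) $ i $ j - H x $ i $ j\<bar> powr p \<partial>lebesgue_on \<Omega>) \<le> \<beta> n" for n x i j
    using fs' by auto
  have id_Lp: "id \<in> Lp_vector_functions p \<Omega>"
  proof -
    obtain B where "\<And>x. x \<in> \<Omega> \<Longrightarrow> norm x \<le> B" using \<Omega>(1) bounded_iff by metis
    then have "\<bar>x $ i\<bar> \<le> B" if "x \<in> \<Omega>" for x i using component_le_norm_cart that order_trans by blast
    moreover have "(\<lambda>x. x $ i) \<in> borel_measurable (lebesgue_on \<Omega>)" for i
      using lm by (intro continuous_imp_measurable_on_sets_lebesgue continuous_intros) auto
    ultimately show ?thesis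
      using p by (auto simp: Lp_vector_functions_def intro!: bounded_measurable_in_Lp_functions[OF lm])
  qed
  have H_Lp: "H \<in> Lp_matrix_functions p \<Omega>"
  proof -
    have "(\<lambda>x. H x $ i $ j) \<in> Lp_functions p \<Omega>" for i j
    proof (rule bounded_measurable_in_Lp_functions[OF lm])
      show "(\<lambda>x. H x $ i $ j) \<in> borel_measurable (lebesgue_on \<Omega>)"
        using H \<Omega> by (intro riemann_integrable_measurable) (auto simp: matrix_riemann_integrable_on_def)
      show "\<bar>H x $ i $ j\<bar> \<le> 1" if "x \<in> \<Omega>" for x
        using SO that by (intro orthogonal_matrix_entry_le_1) (auto simp: special_orthogonal_def)
    qed (use p in auto)
    then show ?thesis by (simp add: Lp_matrix_functions_def)
  qed
  have unif: "uniform_limit \<Omega> fs id sequentially"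
    unfolding uniform_limit_iff
  proof (intro allI impI)
    fix e :: real assume "e > 0"
    have "(\<lambda>n. 2 * \<epsilon> n) \<longlonglongrightarrow> 0" using tendsto_mult_right_zero[OF \<epsilon>0] .
    then have "\<forall>\<^sub>F n in sequentially. 2 * \<epsilon> n < e" using \<open>e > 0\<close> by (rule order_tendstoD)
    then show "\<forall>\<^sub>F n in sequentially. \<forall>x\<in>\<Omega>. dist (fs n x) (id x) < e"
    proof eventually_elim
      case (elim n)
      then show ?case using fs(2)[of _ n] by (auto simp: dist_norm intro: le_less_trans)
    qed
  qed
  have \<beta>0: "\<beta> \<longlonglongrightarrow> 0"
  proof -
    have "(\<lambda>n. \<epsilon> n powr p) \<longlonglongrightarrow> 0"
      by (rule tendsto_zero_powrI[OF \<epsilon>0 tendsto_const]) (use \<epsilon> p in \<open>auto intro!: always_eventually less_imp_le\<close>)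
    then have "\<beta> \<longlonglongrightarrow> 2 powr p * 0 + (0 + 0) * measure lebesgue \<Omega>"
      unfolding \<beta>_def[abs_def] by (intro tendsto_intros \<epsilon>0)
    then show ?thesis by simp
  qed
  have \<beta>_nonneg: "0 \<le> \<beta> n" for n using \<epsilon>[of n] by (auto simp: \<beta>_def intro!: add_nonneg_nonneg)
  let ?D = "\<lambda>n x. jacobian (fs n) (at x) - H x"
  have q: "Lp_matrix_quasinorm p \<Omega> (?D n) \<in> {0..\<beta> n powr (1 / p)}" for n
  proof -
    let ?S = "{Lp_quasinorm p \<Omega> (\<lambda>x. ?D n x $ i $ j) | i j. True}"
    have "?S = (\<lambda>(i, j). Lp_quasinorm p \<Omega> (\<lambda>x. ?D n x $ i $ j)) ` UNIV" by auto
    then have "finite ?S" "?S \<noteq> {}" by auto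
    then have "Max ?S \<in> ?S" by (rule Max_in)
    then obtain i j where ij: "Lp_matrix_quasinorm p \<Omega> (?D n) = Lp_quasinorm p \<Omega> (\<lambda>x. ?D n x $ i $ j)"
      unfolding Lp_matrix_quasinorm_def by blast
    have "Lp_quasinorm p \<Omega> (\<lambda>x. ?D n x $ i $ j) \<le> \<beta> n powr (1 / p)"
      unfolding Lp_quasinorm_def using fs(4)[of n i j] p by (intro powr_mono2) (auto intro: integral_nonneg_AE)
    then show ?thesis using ij by (auto simp: Lp_quasinorm_def)
  qed
  have lim: "(\<lambda>n. \<beta> n powr (1 / p)) \<longlonglongrightarrow> 0"
    by (rule tendsto_zero_powrI[OF \<beta>0 tendsto_const]) (use \<beta>_nonneg p in auto)
  have "(\<lambda>n. Lp_matrix_quasinorm p \<Omega> (?D n)) \<longlonglongrightarrow> 0"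
    by (rule tendsto_sandwich[OF _ _ tendsto_const lim]) (use q in \<open>auto intro!: always_eventually\<close>)
  then have "converges_in_Lp_matrix p \<Omega> (\<lambda>n x. jacobian (fs n) (at x)) H"
    using fs(3) H_Lp by (simp add: converges_in_Lp_matrix_def)
  with fs(1) unif id_Lp H_Lp show ?thesis
    unfolding M1p_def by blast
qed

end
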